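(* Let $M=(\mathcal{S},\mathcal{A},H,P,r,\mu)$ be a finite-horizon MDP with $\mathcal{S}\times\mathcal{A}$ compact, and assume that for each $h\in[H]$ and $f\in C(\mathcal{S})$ the map $(s,a)\mapsto\int_{\mathcal{S}}f(s')\,dP(s'\mid h,s,a)$ is continuous. Let $k$ be a continuous positive definite kernel on $\mathcal{S}\times\mathcal{A}$ with RKHS $\mathcal{H}_k$, and let $\rho$ be a Borel probability measure on $\mathcal{S}\times\mathcal{A}$ with full support. Let $(\lambda_i)_{i\ge1}$ be the positive eigenvalues (nonincreasing, with multiplicity) of the integral operator $(\mathcal{K}_\rho g)(x)=\int k(x,x')g(x')\,d\rho(x')$ on $L^2(\rho)$, assumed infinitely many, and $(\psi_i)_{i\ge1}$ corresponding eigenfunctions, orthonormal in $L^2(\rho)$. Then the following are equivalent. (1) For every $h\in[H]$: $r(h,\cdot)\in\mathcal{H}_k$, and there exist finite signed Borel measures $(\mu_h^i)_{i\ge1}$ on $\mathcal{S}$ and a constant $C>0$ such that for every $f\in C(\mathcal{S})$, $$\int_{\mathcal{S}}f(s')\,dP(s'\mid h,s,a)=\sum_{i=1}^{\infty}\Big(\int_{\mathcal{S}}f\,d\mu_h^i\Big)\psi_i(s,a),$$ with the series converging in $L^2(\rho)$ (the equality holding $\rho$-a.e. in $(s,a)$), and $$\sum_{i=1}^\infty\frac{1}{\lambda_i}\Big|\int_{\mathcal{S}}f\,d\mu_h^i\Big|^2\le C\|f\|_{C(\mathcal{S})}^2.$$ (2) There is a constant $C'>0$ such that for every $h\in[H]$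 and $f\in C(\mathcal{S})$, the function $(\mathcal{T}_hf)(s,a)=r(h,s,a)+\mathbb{E}_{s'\sim P(\cdot\mid h,s,a)}[f(s')]$ belongs to $\mathcal{H}_k$ and $\|\mathcal{T}_hf\|_{\mathcal{H}_k}\le C'(\|f\|_{C(\mathcal{S})}+1)$.
   Context: A finite-horizon MDP $M=(\mathcal{S},\mathcal{A},H,P,r,\mu)$: state space $\mathcal{S}$, action space $\mathcal{A}$ (subsets of Euclidean spaces), horizon $H$, Borel transition probabilities $P(\cdot\mid h,s,a)$ on $\mathcal{S}$, continuous deterministic reward $r:[H]\times\mathcal{S}\times\mathcal{A}\to[0,1]$, initial distribution $\mu$. $C(\mathcal{S})$ is the space of bounded continuous functions on $\mathcal{S}$ with sup norm. A continuous positive definite kernel $k$ is symmetric with $\sum_{i,j}a_ia_jk(x_i,x_j)\ge0$ for all finite choices; $\mathcal{H}_k$ is its reproducing kernel Hilbert space with norm $\|\cdot\|_{\mathcal{H}_k}$. *)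

theory Defs
  imports "HOL-Probability.Probability"
begin

definition bcont_on :: "'s::metric_space set \<Rightarrow> ('s \<Rightarrow> real) \<Rightarrow> bool" where
  "bcont_on S f \<longleftrightarrow> continuous_on S f \<and> bounded (f ` S)"

definition sup_norm_on :: "'s set \<Rightarrow> ('s \<Rightarrow> real) \<Rightarrow> real" where
  "sup_norm_on S f = (SUP s\<in>S. \<bar>f s\<bar>)"

section \<open>Positive definite kernels and their RKHS (Aronszajn construction)\<close>

definition pd_kernel_on :: "'x set \<Rightarrow> ('x \<Rightarrow> 'x \<Rightarrow> real) \<Rightarrow> bool" where
  "pd_kernel_on X k \<longleftrightarrow>
     (\<forall>x\<in>X. \<forall>y\<in>X. k x y = k y x) \<and>
     (\<forall>cs :: (real \<times> 'x) list. set (map snd cs) \<subseteq> X \<longrightarrow>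
        (\<Sum>(c,y)\<leftarrow>cs. \<Sum>(d,z)\<leftarrow>cs. c * d * k y z) \<ge> 0)"

text \<open>A finite combination sum_i c_i k(y_i, .) is represented by the list of pairs (c_i, y_i).\<close>

definition kcomb_eval :: "('x \<Rightarrow> 'x \<Rightarrow> real) \<Rightarrow> (real \<times> 'x) list \<Rightarrow> 'x \<Rightarrow> real" where
  "kcomb_eval k cs x = (\<Sum>(c,y)\<leftarrow>cs. c * k y x)"

definition kcomb_norm2 :: "('x \<Rightarrow> 'x \<Rightarrow> real) \<Rightarrow> (real \<times> 'x) list \<Rightarrow> real" where
  "kcomb_norm2 k cs = (\<Sum>(c,y)\<leftarrow>cs. \<Sum>(d,z)\<leftarrow>cs. c * d * k y z)"

definition kcomb_diff :: "(real \<times> 'x) list \<Rightarrow> (real \<times> 'x) list \<Rightarrow> (real \<times> 'x) list" where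
  "kcomb_diff cs ds = cs @ map (\<lambda>(d,z). (- d, z)) ds"

definition rkhs_approx ::
  "('x \<Rightarrow> 'x \<Rightarrow> real) \<Rightarrow> 'x set \<Rightarrow> ('x \<Rightarrow> real) \<Rightarrow> (nat \<Rightarrow> (real \<times> 'x) list) \<Rightarrow> bool" where
  "rkhs_approx k X g cs \<longleftrightarrow>
     (\<forall>n. set (map snd (cs n)) \<subseteq> X) \<and>
     (\<forall>e>0. \<exists>N. \<forall>m\<ge>N. \<forall>n\<ge>N. kcomb_norm2 k (kcomb_diff (cs m) (cs n)) < e) \<and>
     (\<forall>x\<in>X. (\<lambda>n. kcomb_eval k (cs n) x) \<longlonglongrightarrow> g x)"

definition in_rkhs :: "('x \<Rightarrow> 'x \<Rightarrow> real) \<Rightarrow> 'x set \<Rightarrow> ('x \<Rightarrow> real) \<Rightarrow> bool" where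
  "in_rkhs k X g \<longleftrightarrow> (\<exists>cs. rkhs_approx k X g cs)"

definition rkhs_norm :: "('x \<Rightarrow> 'x \<Rightarrow> real) \<Rightarrow> 'x set \<Rightarrow> ('x \<Rightarrow> real) \<Rightarrow> real" where
  "rkhs_norm k X g = lim (\<lambda>n. sqrt (kcomb_norm2 k ((SOME cs. rkhs_approx k X g cs) n)))"

section \<open>Finite signed measures, represented as differences of two finite measures\<close>

definition fin_signed_measure_on :: "'s::topological_space set \<Rightarrow> 's measure \<times> 's measure \<Rightarrow> bool" where
  "fin_signed_measure_on S m \<longleftrightarrow>
     finite_measure (fst m) \<and> finite_measure (snd m) \<and>
     sets (fst m) = sets (restrict_space borel S) \<and> sets (snd m) = sets (restrict_space borel S)"

definition signed_integral :: "'s measure \<times> 's measure \<Rightarrow> ('s \<Rightarrow> real) \<Rightarrow> real" where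
  "signed_integral m f = (\<integral>x. f x \<partial>(fst m)) - (\<integral>x. f x \<partial>(snd m))"

definition full_support_on :: "'x::topological_space set \<Rightarrow> 'x measure \<Rightarrow> bool" where
  "full_support_on X \<rho> \<longleftrightarrow> (\<forall>U. openin (top_of_set X) U \<and> U \<noteq> {} \<longrightarrow> emeasure \<rho> U > 0)"

end

theory Submission
  imports Defs "HOL-Complex_Analysis.Great_Picard"
begin

text \<open>
  Mercer's theorem identifies \<open>\<H>\<^sub>k\<close> with the weighted \<open>\<ell>\<^sup>2\<close> space of coefficients: a continuous function
  \<open>g\<close> lies in \<open>\<H>\<^sub>k\<close> with norm \<open>\<le> M\<close> iff \<open>g = \<Sum>i. c\<^sub>i \<psi>\<^sub>i\<close> in \<open>L\<^sup>2(\<rho>)\<close> with \<open>\<Sum>i. c\<^sub>i\<^sup>2 / \<lambda>\<^sub>i \<le> M\<^sup>2\<close>.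
  Condition (1) then says that \<open>f \<mapsto> E\<^sub>h f\<close> (the expectation under \<open>P\<close>) is a bounded linear map into \<open>\<H>\<^sub>k\<close>
  and that \<open>r\<close> lies in \<open>\<H>\<^sub>k\<close>, which by rescaling \<open>f\<close> is the same as (2).
  The coefficient functionals \<open>f \<mapsto> \<langle>E\<^sub>h f, \<psi>\<^sub>i\<rangle>\<close> are the integrals against the signed mixtures
  \<open>\<integral> P(\<cdot> | h, x) \<psi>\<^sub>i(x) d\<rho>(x)\<close>.
\<close>

section \<open>Square-summable coefficients and the RKHS of a feature map\<close>

text \<open>The \<open>\<psi> i\<close> and their eigenvalue equations are given only almost
  everywhere, while membership in the RKHS is a pointwise matter. The way out is to pass to
  \<open>Kop (\<psi> i) x / lam i\<close>, which is continuous in x and agrees with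
  \<open>\<psi> i\<close> off a null set; full support then lifts identities between continuous
  functions from almost everywhere to everywhere.

  The expansion of \<open>k\<close> rests on the integral operator vanishing on continuous functions
  orthogonal to all eigenfunctions. The hypothesis on \<open>\<psi>\<close> only excludes further
  eigenfunctions, so an operator that did not vanish there must be made to produce one; this is why
  a variational argument appears.

  The RKHS norm is a limit along an arbitrarily chosen approximating sequence, so it becomes
  computable only once coefficients are known to be unique.

  The operator in (2) is affine and its bound contains "+ 1", hence says nothing sharp for small
  \<open>f\<close>. The value at \<open>f = 0\<close> isolates the reward, and only the linear
  remainder can be rescaled.\<close>

lemma nonneg_quadratic_discriminant:
  fixes A B C :: real
  assumes "\<And>t. 0 \<le> A * t\<^sup>2 + 2 * B * t + C"
  shows "B\<^sup>2 \<le> A * C"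
\<comment> \<open>The degenerate case has to be covered: the Cauchy-Schwarz inequalities below,
  including the one for a merely semidefinite form, are all instances of this lemma.\<close>
proof (cases "A = 0")
  case True
  have "B = 0"
  proof (rule ccontr)
    assume "B \<noteq> 0"
    then show False using assms[of "-(C + 1) / (2 * B)"] True by simp
  qed
  then show ?thesis using True by simp
next
  case False
  have "0 < A"
  proof (rule ccontr)
    assume "\<not> 0 < A"
    then have "A < 0" using False by simp
    \<comment> \<open>Chosen so that \<open>t\<close> is at least 1 and \<open>A * t\<close> is at
      most \<open>-(2 * \<bar>B\<bar> + \<bar>C\<bar> + 1)\<close>; the leading term then beats the
      other two and the quadratic is at most \<open>- t\<close>.\<close>
    define t where "t = (2 * \<bar>B\<bar> + \<bar>C\<bar> + 1) / (- A)+ 1"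
    have t1: "t \<ge> 1" using \<open>A < 0\<close> by (simp add: t_def divide_nonneg_neg)
    have "A * t \<le> - (2 * \<bar>B\<bar> + \<bar>C\<bar> + 1)" using \<open>A < 0\<close> by (simp add: t_def field_simps)
    then have "A * t * t \<le> - (2 * \<bar>B\<bar> + \<bar>C\<bar> + 1) * t" using t1 by (intro mult_right_mono) auto
    moreover have "2 * B * t \<le> 2 * \<bar>B\<bar> * t" using t1 by (intro mult_right_mono) auto
    moreover have "C \<le> \<bar>C\<bar> * t" using t1 mult_left_mono[of 1 t "\<bar>C\<bar>"] by simp
    ultimately have "A * t\<^sup>2 + 2 * B * t + C \<le> - t" by (simp add: power2_eq_square algebra_simps)
    then show False using assms[of t] t1 by simp
  qed
  then show ?thesis using assms[of "- B / A"] by (simp add: field_simps power2_eq_square)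
qed

section \<open>Inner products of square-summable sequences\<close>

lemma summable_mult_of_squares:
  fixes a b :: "nat \<Rightarrow> real"
  assumes "summable (\<lambda>i. (a i)\<^sup>2)" "summable (\<lambda>i. (b i)\<^sup>2)"
  shows "summable (\<lambda>i. \<bar>a i * b i\<bar>)" "summable (\<lambda>i. a i * b i)"
proof -
  have "norm \<bar>x * y\<bar> \<le> x\<^sup>2 + y\<^sup>2" for x y :: real
  proof -
    have "2 * (\<bar>x\<bar> * \<bar>y\<bar>) \<le> x\<^sup>2 + y\<^sup>2" using sum_squares_bound[of "\<bar>x\<bar>" "\<bar>y\<bar>"] by (simp add: mult.assoc)
    moreover have "0 \<le> \<bar>x\<bar> * \<bar>y\<bar>" by simp
    ultimately have "\<bar>x\<bar> * \<bar>y\<bar> \<le> x\<^sup>2 + y\<^sup>2" by linarith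
    then show ?thesis by (simp add: abs_mult)
  qed
  then show *: "summable (\<lambda>i. \<bar>a i * b i\<bar>)"
    by (intro summable_comparison_test'[OF summable_add[OF assms]]) auto
  then show "summable (\<lambda>i. a i * b i)" by (rule summable_rabs_cancel)
qed

lemma summable_square_lincomb:
  fixes a b :: "nat \<Rightarrow> real"
  assumes "summable (\<lambda>i. (a i)\<^sup>2)" "summable (\<lambda>i. (b i)\<^sup>2)"
  shows "summable (\<lambda>i. (s * a i + t * b i)\<^sup>2)"
    and "(\<Sum>i. (s * a i + t * b i)\<^sup>2)
         = s\<^sup>2 * (\<Sum>i. (a i)\<^sup>2) + 2 * s * t * (\<Sum>i. a i * b i) + t\<^sup>2 * (\<Sum>i. (b i)\<^sup>2)"
proof -
  have "(\<lambda>i. s\<^sup>2 * (a i)\<^sup>2 + 2 * s * t * (a i * b i) + t\<^sup>2 * (b i)\<^sup>2) sums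
    (s\<^sup>2 * (\<Sum>i. (a i)\<^sup>2) + 2 * s * t * (\<Sum>i. a i * b i) + t\<^sup>2 * (\<Sum>i. (b i)\<^sup>2))"
    using assms summable_mult_of_squares(2)[OF assms] by (intro sums_add sums_mult summable_sums)
  then have "(\<lambda>i. (s * a i + t * b i)\<^sup>2) sums
    (s\<^sup>2 * (\<Sum>i. (a i)\<^sup>2) + 2 * s * t * (\<Sum>i. a i * b i) + t\<^sup>2 * (\<Sum>i. (b i)\<^sup>2))"
    by (simp add: power2_eq_square algebra_simps)
  then show "summable (\<lambda>i. (s * a i + t * b i)\<^sup>2)"
    and "(\<Sum>i. (s * a i + t * b i)\<^sup>2)
         = s\<^sup>2 * (\<Sum>i. (a i)\<^sup>2) + 2 * s * t * (\<Sum>i. a i * b i) + t\<^sup>2 * (\<Sum>i. (b i)\<^sup>2)"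
    by (auto simp: sums_iff)
qed

lemma Cauchy_Schwarz_suminf:
  fixes a b :: "nat \<Rightarrow> real"
  assumes "summable (\<lambda>i. (a i)\<^sup>2)" "summable (\<lambda>i. (b i)\<^sup>2)"
  shows "(\<Sum>i. a i * b i)\<^sup>2 \<le> (\<Sum>i. (a i)\<^sup>2) * (\<Sum>i. (b i)\<^sup>2)"
proof (rule nonneg_quadratic_discriminant)
  fix t :: real
  have "0 \<le> (\<Sum>i. (t * a i + 1 * b i)\<^sup>2)"
    by (rule suminf_nonneg[OF summable_square_lincomb(1)[OF assms]]) simp
  then show "0 \<le> (\<Sum>i. (a i)\<^sup>2) * t\<^sup>2 + 2 * (\<Sum>i. a i * b i) * t + (\<Sum>i. (b i)\<^sup>2)"
    unfolding summable_square_lincomb(2)[OF assms] by (simp add: algebra_simps)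
qed

text \<open>Write Phi(y) for the sequence of all \<open>\<phi> i y\<close>. A combination of kernel
  sections k(y, .) corresponds to the same combination of the vectors Phi(y) in l^2; this is its
  i-th coordinate.\<close>

definition kcomb_coeff :: "(nat \<Rightarrow> 'x \<Rightarrow> real) \<Rightarrow> (real \<times> 'x) list \<Rightarrow> nat \<Rightarrow> real" where
  "kcomb_coeff \<phi> cs i = (\<Sum>(c,y)\<leftarrow>cs. c * \<phi> i y)"

lemma kcomb_coeff_simps [simp]:
  "kcomb_coeff \<phi> [] i = 0"
  "kcomb_coeff \<phi> ((c,y) # cs) i = c * \<phi> i y + kcomb_coeff \<phi> cs i"
  "kcomb_coeff \<phi> (cs @ ds) i = kcomb_coeff \<phi> cs i + kcomb_coeff \<phi> ds i"
  by (simp_all add: kcomb_coeff_def)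

lemma kcomb_coeff_scale [simp]:
  "kcomb_coeff \<phi> (map (\<lambda>(c,y). (t * c, y)) cs) i = t * kcomb_coeff \<phi> cs i"
  by (induction cs) (auto simp: algebra_simps)

lemma kcomb_coeff_diff [simp]:
  "kcomb_coeff \<phi> (kcomb_diff cs ds) i = kcomb_coeff \<phi> cs i - kcomb_coeff \<phi> ds i"
proof -
  have "kcomb_coeff \<phi> (map (\<lambda>(d,z). (- d, z)) ds) i = - kcomb_coeff \<phi> ds i"
    by (induction ds) auto
  then show ?thesis by (simp add: kcomb_diff_def)
qed

text \<open>The first assumption makes \<open>k x y\<close> the l^2 inner product of Phi(x) and
  Phi(y). The second says that only 0 is orthogonal to every Phi(x), so a function has at most one
  square-summable expansion and the RKHS is isometric to l^2 itself instead of a quotient.\<close>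

locale feature_kernel =
  fixes X :: "'x set" and k :: "'x \<Rightarrow> 'x \<Rightarrow> real" and \<phi> :: "nat \<Rightarrow> 'x \<Rightarrow> real"
  assumes feature: "\<And>x y. x \<in> X \<Longrightarrow> y \<in> X \<Longrightarrow> (\<lambda>i. \<phi> i x * \<phi> i y) sums k x y"
    and feature_inj: "\<And>a i. summable (\<lambda>i. (a i)\<^sup>2) \<Longrightarrow>
      (\<And>x. x \<in> X \<Longrightarrow> (\<lambda>i. a i * \<phi> i x) sums 0) \<Longrightarrow> a i = 0"
begin

lemma feature_summable: "x \<in> X \<Longrightarrow> summable (\<lambda>i. (\<phi> i x)\<^sup>2)"
  using feature[of x x] by (auto simp: power2_eq_square sums_iff)

lemma kernel_sym: "x \<in> X \<Longrightarrow> y \<in> X \<Longrightarrow> k x y = k y x"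
  using feature[of x y] feature[of y x] by (simp add: sums_iff mult.commute)

lemma kcomb_eval_sums:
  assumes "set (map snd cs) \<subseteq> X" "x \<in> X"
  shows "(\<lambda>i. kcomb_coeff \<phi> cs i * \<phi> i x) sums kcomb_eval k cs x"
  using assms(1)
proof (induction cs)
  case Nil
  then show ?case by (simp add: kcomb_eval_def)
next
  case (Cons p cs)
  obtain c y where p: "p = (c, y)" by force
  have "(\<lambda>i. c * (\<phi> i y * \<phi> i x) + kcomb_coeff \<phi> cs i * \<phi> i x) sums (c * k y x + kcomb_eval k cs x)"
    using Cons p assms(2) by (intro sums_add sums_mult feature) auto
  then show ?case by (simp add: p kcomb_eval_def algebra_simps)
qed

lemma kcomb_norm2_sums:
  assumes "set (map snd cs) \<subseteq> X"
  shows "(\<lambda>i. (kcomb_coeff \<phi> cs i)\<^sup>2) sums kcomb_norm2 k cs"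
proof -
  \<comment> \<open>The bilinear version with an independent second list: induction on
    \<open>ds\<close> keeps \<open>cs\<close> fixed, whereas in the quadratic version both sums
    would grow together.\<close>
  have "(\<lambda>i. kcomb_coeff \<phi> ds i * kcomb_coeff \<phi> cs i) sums (\<Sum>(c,y)\<leftarrow>ds. \<Sum>(d,z)\<leftarrow>cs. c * d * k y z)"
    if "set (map snd ds) \<subseteq> X" for ds
    using that
  proof (induction ds)
    case Nil
    then show ?case by simp
  next
    case (Cons p ds)
    obtain c y where p: "p = (c, y)" by force
    have y: "y \<in> X" using Cons p by simp
    have "(\<lambda>i. kcomb_coeff \<phi> cs i * \<phi> i y) sums kcomb_eval k cs y"
      using assms y by (rule kcomb_eval_sums)
    moreover have "kcomb_eval k cs y = (\<Sum>(d,z)\<leftarrow>cs. d * k y z)"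
      using assms y feature unfolding kcomb_eval_def
      by (intro arg_cong[where f=sum_list] map_cong) (auto simp: kernel_sym)
    moreover have "c * (\<Sum>(d,z)\<leftarrow>cs. d * k y z) = (\<Sum>(d,z)\<leftarrow>cs. c * d * k y z)"
      by (induction cs) (auto simp: algebra_simps)
    ultimately have "(\<lambda>i. c * (kcomb_coeff \<phi> cs i * \<phi> i y)) sums (\<Sum>(d,z)\<leftarrow>cs. c * d * k y z)"
      using sums_mult by metis
    from sums_add[OF this Cons.IH] show ?case using Cons.prems p by (simp add: algebra_simps)
  qed
  from this[OF assms] show ?thesis by (simp add: kcomb_norm2_def power2_eq_square)
qed

text \<open>Completeness of l^2: the coefficient sequences of a Cauchy sequence of combinations
  converge coordinatewise, the limit \<open>a\<close> is also a limit in norm, and both evaluation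
  at a point and the norm are continuous in l^2.\<close>

lemma rkhs_approx_coeffs:
  assumes "rkhs_approx k X g cs"
  shows "\<exists>a. summable (\<lambda>i. (a i)\<^sup>2) \<and> (\<forall>x\<in>X. (\<lambda>i. a i * \<phi> i x) sums g x) \<and>
    (\<lambda>n. sqrt (kcomb_norm2 k (cs n))) \<longlonglongrightarrow> sqrt (\<Sum>i. (a i)\<^sup>2)"
proof -
  have csX: "set (map snd (cs n)) \<subseteq> X" for n using assms by (simp add: rkhs_approx_def)
  then have diffX: "set (map snd (kcomb_diff (cs m) (cs n))) \<subseteq> X" for m n
    by (force simp: kcomb_diff_def image_subset_iff)
  have cau: "\<exists>N. \<forall>m\<ge>N. \<forall>n\<ge>N. kcomb_norm2 k (kcomb_diff (cs m) (cs n)) < e" if "e > 0" for e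
    using assms that by (simp add: rkhs_approx_def)
  have lim: "(\<lambda>n. kcomb_eval k (cs n) x) \<longlonglongrightarrow> g x" if "x \<in> X" for x
    using assms that by (simp add: rkhs_approx_def)
  define p where "p n i = kcomb_coeff \<phi> (cs n) i" for n i
  have p_sum: "(\<lambda>i. (p n i)\<^sup>2) sums kcomb_norm2 k (cs n)" for n
    unfolding p_def by (rule kcomb_norm2_sums[OF csX])
  have pdiff: "(\<lambda>i. (p m i - p n i)\<^sup>2) sums kcomb_norm2 k (kcomb_diff (cs m) (cs n))" for m n
    using kcomb_norm2_sums[OF diffX] by (simp add: p_def)
  have partial: "(\<Sum>i<N. (p m i - p n i)\<^sup>2) \<le> kcomb_norm2 k (kcomb_diff (cs m) (cs n))" for N m n
    using pdiff[of m n] sum_le_suminf[of "\<lambda>i. (p m i - p n i)\<^sup>2" "{..<N}"] by (auto simp: sums_iff)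
  have "Cauchy (\<lambda>n. p n i)" for i
  proof (rule metric_CauchyI)
    fix e :: real assume "e > 0"
    then obtain N where N: "\<forall>m\<ge>N. \<forall>n\<ge>N. kcomb_norm2 k (kcomb_diff (cs m) (cs n)) < e\<^sup>2"
      using cau[of "e\<^sup>2"] by auto
    have "dist (p m i) (p n i) < e" if "m \<ge> N" "n \<ge> N" for m n
    proof -
      have "(p m i - p n i)\<^sup>2 \<le> (\<Sum>j<Suc i. (p m j - p n j)\<^sup>2)" by (simp add: sum_nonneg)
      also have "\<dots> < e\<^sup>2" using partial[where N = "Suc i" and m = m and n = n] N that by fastforce
      finally show ?thesis using \<open>e > 0\<close> power2_less_imp_less[of "\<bar>p m i - p n i\<bar>" e]
        by (simp add: dist_real_def)
    qed
    then show "\<exists>M. \<forall>m\<ge>M. \<forall>n\<ge>M. dist (p m i) (p n i) < e" by blast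
  qed
  then have "\<exists>l. (\<lambda>n. p n i) \<longlonglongrightarrow> l" for i using real_Cauchy_convergent convergent_def by metis
  then obtain a where a: "\<And>i. (\<lambda>n. p n i) \<longlonglongrightarrow> a i" by metis
  have tail: "\<exists>N. \<forall>n\<ge>N. summable (\<lambda>i. (p n i - a i)\<^sup>2) \<and> (\<Sum>i. (p n i - a i)\<^sup>2) \<le> e" if "e > 0" for e
  proof -
    obtain N where N: "\<forall>m\<ge>N. \<forall>n\<ge>N. kcomb_norm2 k (kcomb_diff (cs m) (cs n)) < e" using cau \<open>e > 0\<close> by blast
    \<comment> \<open>Fatou's argument: the finite sums are bounded for each \<open>m\<close>, then
      \<open>m\<close> tends to infinity with \<open>M\<close> fixed, and only afterwards
      \<open>M\<close> grows.\<close>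
    have "(\<Sum>i<M. (p n i - a i)\<^sup>2) \<le> e" if "n \<ge> N" for M n
    proof (rule tendsto_upperbound)
      show "(\<lambda>m. \<Sum>i<M. (p n i - p m i)\<^sup>2) \<longlonglongrightarrow> (\<Sum>i<M. (p n i - a i)\<^sup>2)"
        by (intro tendsto_intros a)
      show "\<forall>\<^sub>F m in sequentially. (\<Sum>i<M. (p n i - p m i)\<^sup>2) \<le> e"
        using partial N that unfolding eventually_sequentially by (meson less_imp_le order_trans)
    qed simp
    then have "summable (\<lambda>i. (p n i - a i)\<^sup>2) \<and> (\<Sum>i. (p n i - a i)\<^sup>2) \<le> e" if "n \<ge> N" for n
      using that by (intro conjI suminf_le_const summableI_nonneg_bounded[where x = e]) auto
    then show ?thesis by blast
  qed
  obtain N0 where N0: "\<And>n. n \<ge> N0 \<Longrightarrow> summable (\<lambda>i. (p n i - a i)\<^sup>2)" using tail[of 1] by auto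
  have asum: "summable (\<lambda>i. (a i)\<^sup>2)"
    using summable_square_lincomb(1)[OF sums_summable[OF p_sum[of N0]] N0[OF order.refl], of 1 "-1"] by simp
  have d0: "(\<lambda>n. \<Sum>i. (p n i - a i)\<^sup>2) \<longlonglongrightarrow> 0"
  proof (rule LIMSEQ_I)
    fix e :: real assume "e > 0"
    then obtain N where "\<forall>n\<ge>N. summable (\<lambda>i. (p n i - a i)\<^sup>2) \<and> (\<Sum>i. (p n i - a i)\<^sup>2) \<le> e/2"
      using tail[of "e/2"] by auto
    then have "\<forall>n\<ge>N. norm ((\<Sum>i. (p n i - a i)\<^sup>2) - 0) < e"
      using \<open>e > 0\<close> suminf_nonneg[of "\<lambda>i. (p _ i - a i)\<^sup>2"] by force
    then show "\<exists>N. \<forall>n\<ge>N. norm ((\<Sum>i. (p n i - a i)\<^sup>2) - 0) < e" by blast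
  qed
  \<comment> \<open>Used twice: with \<open>b\<close> = Phi(x) it gives convergence of the values at
    \<open>x\<close>, with \<open>b = a\<close> it removes the cross term when the squared norm is
    expanded.\<close>
  have weak: "(\<lambda>n. \<Sum>i. (p n i - a i) * b i) \<longlonglongrightarrow> 0" if b: "summable (\<lambda>i. (b i)\<^sup>2)" for b
  proof (rule Lim_null_comparison)
    show "\<forall>\<^sub>F n in sequentially. norm (\<Sum>i. (p n i - a i) * b i) \<le> sqrt ((\<Sum>i. (p n i - a i)\<^sup>2) * (\<Sum>i. (b i)\<^sup>2))"
      unfolding eventually_sequentially using Cauchy_Schwarz_suminf[OF N0 b]
      by (intro exI[of _ N0]) (auto intro!: real_le_rsqrt simp del: real_sqrt_mult)
    show "(\<lambda>n. sqrt ((\<Sum>i. (p n i - a i)\<^sup>2) * (\<Sum>i. (b i)\<^sup>2))) \<longlonglongrightarrow> 0"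
      using tendsto_real_sqrt[OF tendsto_mult_left_zero[OF d0]] by simp
  qed
  have "(\<lambda>i. a i * \<phi> i x) sums g x" if x: "x \<in> X" for x
  proof -
    note s = feature_summable[OF x]
    have sa: "summable (\<lambda>i. a i * \<phi> i x)" by (rule summable_mult_of_squares[OF asum s])
    have ev: "(\<lambda>i. p n i * \<phi> i x) sums kcomb_eval k (cs n) x" for n
      unfolding p_def by (rule kcomb_eval_sums[OF csX x])
    have "(\<Sum>i. (p n i - a i) * \<phi> i x) = kcomb_eval k (cs n) x - (\<Sum>i. a i * \<phi> i x)" for n
      using sums_diff[OF ev summable_sums[OF sa], of n] by (simp add: sums_iff algebra_simps)
    with weak[OF s] have "(\<lambda>n. kcomb_eval k (cs n) x - (\<Sum>i. a i * \<phi> i x)) \<longlonglongrightarrow> 0" by simp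
    then have "(\<lambda>n. kcomb_eval k (cs n) x) \<longlonglongrightarrow> (\<Sum>i. a i * \<phi> i x)" by (rule LIM_zero_cancel)
    then show ?thesis using lim[OF x] LIMSEQ_unique summable_sums[OF sa] by metis
  qed
  moreover have "(\<lambda>n. sqrt (kcomb_norm2 k (cs n))) \<longlonglongrightarrow> sqrt (\<Sum>i. (a i)\<^sup>2)"
  proof (rule tendsto_real_sqrt)
    have "(\<lambda>n. (\<Sum>i. (p n i - a i)\<^sup>2) + 2 * (\<Sum>i. (p n i - a i) * a i) + (\<Sum>i. (a i)\<^sup>2))
      \<longlonglongrightarrow> 0 + 2 * 0 + (\<Sum>i. (a i)\<^sup>2)"
      by (intro tendsto_intros d0 weak asum)
    moreover have "\<forall>\<^sub>F n in sequentially. (\<Sum>i. (p n i - a i)\<^sup>2) + 2 * (\<Sum>i. (p n i - a i) * a i) + (\<Sum>i. (a i)\<^sup>2)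
      = kcomb_norm2 k (cs n)"
      unfolding eventually_sequentially
      using summable_square_lincomb(2)[OF N0 asum, of _ 1 1] p_sum
      by (intro exI[of _ N0]) (simp add: sums_iff)
    ultimately show "(\<lambda>n. kcomb_norm2 k (cs n)) \<longlonglongrightarrow> (\<Sum>i. (a i)\<^sup>2)"
      using Lim_transform_eventually by fastforce
  qed
  ultimately show ?thesis using asum by blast
qed

text \<open>\<open>rkhs_norm\<close> is a limit along the one sequence picked by
  \<open>SOME\<close>. Applying the preceding lemma to exactly that sequence yields an expansion
  whose l^2 norm is this limit, without first showing independence of the choice.\<close>

lemma in_rkhs_coeffs:
  assumes "in_rkhs k X g"
  obtains a where "summable (\<lambda>i. (a i)\<^sup>2)" "\<And>x. x \<in> X \<Longrightarrow> (\<lambda>i. a i * \<phi> i x) sums g x"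
    "rkhs_norm k X g = sqrt (\<Sum>i. (a i)\<^sup>2)"
proof -
  have "rkhs_approx k X g (SOME cs. rkhs_approx k X g cs)"
    using assms unfolding in_rkhs_def by (rule someI_ex)
  from rkhs_approx_coeffs[OF this] that show ?thesis unfolding rkhs_norm_def using limI by blast
qed

text \<open>
  The approximating combinations minimise the squared \<open>\<ell>\<^sup>2\<close> distance \<open>D\<close> of their coefficients to \<open>a\<close>: the
  parallelogram law makes a minimising sequence Cauchy, and near-optimality against perturbations
  by \<open>t k(x, \<cdot>)\<close> forces convergence to \<open>g x\<close>.
\<close>

lemma in_rkhs_of_coeffs:
  assumes a: "summable (\<lambda>i. (a i)\<^sup>2)" and g: "\<And>x. x \<in> X \<Longrightarrow> (\<lambda>i. a i * \<phi> i x) sums g x"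
  shows "in_rkhs k X g"
proof -
  define Xl where "Xl = {cs :: (real \<times> 'x) list. set (map snd cs) \<subseteq> X}"
  define D where "D cs = (\<Sum>i. (kcomb_coeff \<phi> cs i - a i)\<^sup>2)" for cs
  have csum: "summable (\<lambda>i. (kcomb_coeff \<phi> cs i)\<^sup>2)" if "cs \<in> Xl" for cs
    using that kcomb_norm2_sums[of cs] by (auto simp: Xl_def sums_iff)
  have dsum: "summable (\<lambda>i. (kcomb_coeff \<phi> cs i - a i)\<^sup>2)" if "cs \<in> Xl" for cs
    using summable_square_lincomb(1)[OF csum[OF that] a, of 1 "-1"] by simp
  have Dnn: "D cs \<ge> 0" if "cs \<in> Xl" for cs
    unfolding D_def by (rule suminf_nonneg[OF dsum[OF that]]) simp
  \<comment> \<open>The infimum is not shown to be 0. Minimising combinations approach the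
    orthogonal projection of \<open>a\<close> onto the closed span of the vectors Phi(y); the
    residual is orthogonal to every Phi(x), so the projection still evaluates to
    \<open>g x\<close>.\<close>
  define d where "d = Inf (D ` Xl)"
  have ne: "Xl \<noteq> {}" by (auto simp: Xl_def intro!: exI[of _ "[]"])
  have dle: "d \<le> D cs" if "cs \<in> Xl" for cs
    unfolding d_def using that Dnn by (intro cInf_lower bdd_belowI[of _ 0]) auto
  have "\<exists>cs\<in>Xl. D cs < d + 1 / real (Suc n)" for n
  proof -
    have "Inf (D ` Xl) < d + 1 / real (Suc n)" by (simp add: d_def)
    then show ?thesis using cInf_lessD[of "D ` Xl"] ne by blast
  qed
  then obtain cs where csX: "\<And>n. cs n \<in> Xl" and cs: "\<And>n. D (cs n) < d + 1 / real (Suc n)" by metis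
  have cauchy: "kcomb_norm2 k (kcomb_diff (cs m) (cs n)) \<le> 2 / real (Suc m) + 2 / real (Suc n)" for m n
  proof -
    \<comment> \<open>The coefficients of \<open>ds\<close> are the means of those of
      \<open>cs m\<close> and \<open>cs n\<close>. Since \<open>D ds\<close> is at least
      \<open>d\<close>, the parallelogram law leaves at most twice the excess of
      \<open>D (cs m)\<close> plus twice the excess of \<open>D (cs n)\<close> over
      \<open>d\<close>.\<close>
    define ds where "ds = map (\<lambda>(c,y). (1/2 * c, y)) (cs m @ cs n)"
    have dsX: "ds \<in> Xl" using csX[of m] csX[of n] by (auto simp: Xl_def ds_def image_subset_iff)
    have dfX: "set (map snd (kcomb_diff (cs m) (cs n))) \<subseteq> X"
      using csX[of m] csX[of n] by (force simp: kcomb_diff_def image_subset_iff Xl_def)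
    have "(kcomb_coeff \<phi> (kcomb_diff (cs m) (cs n)) i)\<^sup>2
        = 2 * (kcomb_coeff \<phi> (cs m) i - a i)\<^sup>2 + 2 * (kcomb_coeff \<phi> (cs n) i - a i)\<^sup>2
          - 4 * (kcomb_coeff \<phi> ds i - a i)\<^sup>2" for i
      unfolding ds_def kcomb_coeff_scale by (simp add: power2_eq_square algebra_simps)
    moreover have "(\<lambda>i. 2 * (kcomb_coeff \<phi> (cs m) i - a i)\<^sup>2 + 2 * (kcomb_coeff \<phi> (cs n) i - a i)\<^sup>2
          - 4 * (kcomb_coeff \<phi> ds i - a i)\<^sup>2) sums (2 * D (cs m) + 2 * D (cs n) - 4 * D ds)"
      unfolding D_def by (intro sums_add sums_diff sums_mult summable_sums dsum csX dsX)
    ultimately have "kcomb_norm2 k (kcomb_diff (cs m) (cs n)) = 2 * D (cs m) + 2 * D (cs n) - 4 * D ds"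
      using kcomb_norm2_sums[OF dfX] by (simp add: sums_iff)
    then show ?thesis using dle[OF dsX] cs[of m] cs[of n] by linarith
  qed
  have lim: "(\<lambda>n. kcomb_eval k (cs n) x) \<longlonglongrightarrow> g x" if x: "x \<in> X" for x
  proof -
    \<comment> \<open>Adding the pair \<open>(t, x)\<close> changes \<open>D\<close> by a quadratic
      in \<open>t\<close> whose linear term carries the error at \<open>x\<close>. As
      \<open>D\<close> can fall by less than \<open>1 / real (Suc n)\<close>, the discriminant
      bounds the squared error.\<close>
    have bound: "(kcomb_eval k (cs n) x - g x)\<^sup>2 \<le> k x x * (1 / real (Suc n))" for n
    proof (rule nonneg_quadratic_discriminant)
      fix t :: real
      have tX: "(t, x) # cs n \<in> Xl" using csX[of n] x by (simp add: Xl_def)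
      have kxx: "(\<Sum>i. (\<phi> i x)\<^sup>2) = k x x" using feature[OF x x] by (simp add: sums_iff power2_eq_square)
      have "(\<lambda>i. \<phi> i x * (kcomb_coeff \<phi> (cs n) i - a i)) sums (kcomb_eval k (cs n) x - g x)"
        using sums_diff[OF kcomb_eval_sums[of "cs n" x] g[OF x]] csX[of n] x
        by (simp add: Xl_def algebra_simps)
      then have "D ((t, x) # cs n) = t\<^sup>2 * k x x + 2 * t * (kcomb_eval k (cs n) x - g x) + D (cs n)"
        using summable_square_lincomb(2)[OF feature_summable[OF x] dsum[OF csX], of t 1 n] kxx
        unfolding D_def by (simp add: sums_iff add_diff_eq)
      then show "0 \<le> k x x * t\<^sup>2 + 2 * (kcomb_eval k (cs n) x - g x) * t + 1 / real (Suc n)"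
        using dle[OF tX] cs[of n] by (simp add: algebra_simps)
    qed
    have "(\<lambda>n. kcomb_eval k (cs n) x - g x) \<longlonglongrightarrow> 0"
    proof (rule Lim_null_comparison)
      show "\<forall>\<^sub>F n in sequentially. norm (kcomb_eval k (cs n) x - g x) \<le> sqrt (k x x * (1 / real (Suc n)))"
        using bound by (intro always_eventually allI) (metis real_norm_def real_sqrt_abs real_sqrt_le_mono)
      have "(\<lambda>n. sqrt (k x x * (1 / real (Suc n)))) \<longlonglongrightarrow> sqrt (k x x * 0)"
        by (intro tendsto_intros LIMSEQ_Suc[OF lim_1_over_n])
      then show "(\<lambda>n. sqrt (k x x * (1 / real (Suc n)))) \<longlonglongrightarrow> 0" by simp
    qed
    then show ?thesis by (rule LIM_zero_cancel)
  qed
  have "\<exists>N. \<forall>m\<ge>N. \<forall>n\<ge>N. kcomb_norm2 k (kcomb_diff (cs m) (cs n)) < e" if "e > 0" for e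
  proof -
    obtain N where "N \<noteq> 0" "inverse (real N) < e / 4" using real_arch_inverse[of "e/4"] \<open>e > 0\<close> by auto
    then have N: "N > 0" "1 / real N < e / 4" by (auto simp: inverse_eq_divide)
    have "kcomb_norm2 k (kcomb_diff (cs m) (cs n)) < e" if "m \<ge> N" "n \<ge> N" for m n
    proof -
      have "2 / real (Suc m) \<le> 2 / real N" "2 / real (Suc n) \<le> 2 / real N"
        using that N(1) by (auto intro!: divide_left_mono)
      then show ?thesis using cauchy[of m n] N(2) by simp
    qed
    then show ?thesis by blast
  qed
  then have "rkhs_approx k X g cs"
    unfolding rkhs_approx_def using csX lim by (auto simp: Xl_def)
  then show ?thesis unfolding in_rkhs_def by blast
qed

text \<open>By \<open>feature_inj\<close> the expansion extracted from the definition of the norm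
  must be the given one.\<close>

lemma rkhs_norm_of_coeffs:
  assumes a: "summable (\<lambda>i. (a i)\<^sup>2)" and g: "\<And>x. x \<in> X \<Longrightarrow> (\<lambda>i. a i * \<phi> i x) sums g x"
  shows "rkhs_norm k X g = sqrt (\<Sum>i. (a i)\<^sup>2)"
proof -
  obtain b where b: "summable (\<lambda>i. (b i)\<^sup>2)" "\<And>x. x \<in> X \<Longrightarrow> (\<lambda>i. b i * \<phi> i x) sums g x"
    and n: "rkhs_norm k X g = sqrt (\<Sum>i. (b i)\<^sup>2)"
    using in_rkhs_coeffs[OF in_rkhs_of_coeffs[OF assms]] by blast
  have "a i - b i = 0" for i
  proof (rule feature_inj[of "\<lambda>i. a i - b i"])
    show "summable (\<lambda>i. (a i - b i)\<^sup>2)" using summable_square_lincomb(1)[OF a b(1), of 1 "-1"] by simp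
    show "(\<lambda>i. (a i - b i) * \<phi> i x) sums 0" if "x \<in> X" for x
      using sums_diff[OF g[OF that] b(2)[OF that]] by (simp add: algebra_simps)
  qed
  then show ?thesis using n by simp
qed

end

section \<open>Integral operators with continuous kernel\<close>

locale compact_kernel =
  fixes X :: "'x::euclidean_space set" and k :: "'x \<Rightarrow> 'x \<Rightarrow> real" and \<rho> :: "'x measure"
  assumes compact_X: "compact X"
    and k_cont: "continuous_on (X \<times> X) (\<lambda>z. k (fst z) (snd z))"
    and k_pd: "pd_kernel_on X k"
    and \<rho>_prob: "prob_space \<rho>"
    and \<rho>_sets: "sets \<rho> = sets (restrict_space borel X)"
    and \<rho>_supp: "full_support_on X \<rho>"

sublocale compact_kernel \<subseteq> prob_space \<rho> by (rule \<rho>_prob)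

context compact_kernel
begin

section \<open>Continuous functions on the compact space \<open>X\<close> and the measure
  \<open>\<rho>\<close>\<close>

lemma space_\<rho> [simp]: "space \<rho> = X"
  using sets_eq_imp_space_eq[OF \<rho>_sets] by (simp add: space_restrict_space)

lemma prob_X [simp]: "prob X = 1"
  using prob_space by simp

lemma X_nonempty: "X \<noteq> {}"
  using not_empty by simp

lemma closed_X: "closed X" using compact_X by (rule compact_imp_closed)

lemma cont_measurable: "continuous_on X f \<Longrightarrow> f \<in> borel_measurable \<rho>"
  for f :: "'x \<Rightarrow> 'b::topological_space"
  by (subst measurable_cong_sets[OF \<rho>_sets refl]) (rule borel_measurable_continuous_on_restrict)

lemma cont_bounded:
  assumes "continuous_on X (f :: 'x \<Rightarrow> real)"
  obtains B where "0 < B" "\<And>x. x \<in> X \<Longrightarrow> \<bar>f x\<bar> \<le> B"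
proof -
  have "bounded (f ` X)" using compact_continuous_image[OF assms compact_X] by (rule compact_imp_bounded)
  then show ?thesis using that unfolding bounded_pos by auto
qed

lemma integrable_of_bound:
  assumes "f \<in> borel_measurable \<rho>" "\<And>x. x \<in> X \<Longrightarrow> \<bar>f x\<bar> \<le> (B::real)"
  shows "integrable \<rho> f"
  by (rule integrable_const_bound[of _ B]) (use assms in \<open>auto intro!: AE_I2\<close>)

lemma cont_integrable: "continuous_on X (f :: 'x \<Rightarrow> real) \<Longrightarrow> integrable \<rho> f"
  by (metis cont_bounded cont_measurable integrable_of_bound)

lemma integral_le_const:
  assumes "integrable \<rho> f" "\<And>x. x \<in> X \<Longrightarrow> f x \<le> (B::real)"
  shows "(\<integral>x. f x \<partial>\<rho>) \<le> B"
proof -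
  have "(\<integral>x. f x \<partial>\<rho>) \<le> (\<integral>x. B \<partial>\<rho>)" using assms by (intro integral_mono) auto
  then show ?thesis by simp
qed

text \<open>Here full support enters: the set where a continuous function is nonzero is relatively
  open, so it can be null only if it is empty.\<close>

lemma cont_AE_zero:
  assumes f: "continuous_on X (f :: 'x \<Rightarrow> real)" and ae: "AE x in \<rho>. f x = 0" and x: "x \<in> X"
  shows "f x = 0"
proof (rule ccontr)
  assume "f x \<noteq> 0"
  define U where "U = X \<inter> f -` (- {0})"
  have "openin (top_of_set X) U" unfolding U_def
    using f by (rule continuous_openin_preimage_gen) auto
  moreover have "U \<noteq> {}" using x \<open>f x \<noteq> 0\<close> by (auto simp: U_def)
  ultimately have "emeasure \<rho> U > 0" using \<rho>_supp unfolding full_support_on_def by blast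
  moreover have "U \<in> sets \<rho>" unfolding U_def
    using measurable_sets[OF cont_measurable[OF f], of "- {0}"] by (simp add: Int_commute)
  then have "emeasure \<rho> U = 0"
    using ae AE_iff_measurable[of U \<rho> "\<lambda>x. f x = 0"] by (auto simp: U_def)
  ultimately show False by simp
qed

lemma integral_square_zero:
  assumes f: "continuous_on X (f :: 'x \<Rightarrow> real)" and z: "(\<integral>x. f x * f x \<partial>\<rho>) = 0" and x: "x \<in> X"
  shows "f x = 0"
proof -
  have "AE x in \<rho>. f x * f x = 0"
    using integral_nonneg_eq_0_iff_AE[of \<rho> "\<lambda>x. f x * f x"] z f
    by (auto intro!: cont_integrable continuous_intros)
  then have "AE x in \<rho>. f x = 0" by simp
  from cont_AE_zero[OF f this x] show ?thesis .
qed

lemma k_sym: "x \<in> X \<Longrightarrow> y \<in> X \<Longrightarrow> k x y = k y x"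
  using k_pd by (simp add: pd_kernel_on_def)

lemma k_section_cont: "x \<in> X \<Longrightarrow> continuous_on X (k x)"
  by (rule continuous_on_compose2[OF k_cont, of X "\<lambda>y. (x, y)", simplified]) (auto intro!: continuous_intros)

lemma k_bounded:
  obtains \<kappa> where "0 < \<kappa>" "\<And>x y. x \<in> X \<Longrightarrow> y \<in> X \<Longrightarrow> \<bar>k x y\<bar> \<le> \<kappa>"
proof -
  have "bounded ((\<lambda>z. k (fst z) (snd z)) ` (X \<times> X))"
    using compact_continuous_image[OF k_cont compact_Times[OF compact_X compact_X]] by (rule compact_imp_bounded)
  then show ?thesis using that unfolding bounded_pos by fastforce
qed

text \<open>Uniform continuity of \<open>k\<close> on the compact square. The modulus does not
  depend on the second argument, which gives continuity of \<open>Kop g\<close> and equicontinuity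
  of all \<open>Kop g\<close> with \<open>g\<close> bounded in L^1.\<close>

lemma k_equicont:
  assumes "0 < e"
  obtains d where "0 < d" "\<And>x x' y. x \<in> X \<Longrightarrow> x' \<in> X \<Longrightarrow> y \<in> X \<Longrightarrow> dist x x' < d \<Longrightarrow> \<bar>k x y - k x' y\<bar> < e"
proof -
  have "uniformly_continuous_on (X \<times> X) (\<lambda>z. k (fst z) (snd z))"
    by (rule compact_uniformly_continuous[OF k_cont compact_Times[OF compact_X compact_X]])
  then obtain d where d: "d > 0" "\<And>z z'. z \<in> X \<times> X \<Longrightarrow> z' \<in> X \<times> X \<Longrightarrow> dist z' z < d \<Longrightarrow>
      dist (k (fst z') (snd z')) (k (fst z) (snd z)) < e"
    using assms unfolding uniformly_continuous_on_def by meson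
  have "\<bar>k x y - k x' y\<bar> < e" if "x \<in> X" "x' \<in> X" "y \<in> X" "dist x x' < d" for x x' y
    using d(2)[of "(x', y)" "(x, y)"] that by (simp add: dist_Pair_Pair dist_real_def)
  with d(1) that show ?thesis by blast
qed

section \<open>The integral operator as a map on functions, with continuous values\<close>

definition Kop :: "('x \<Rightarrow> real) \<Rightarrow> 'x \<Rightarrow> real" where
  "Kop g x = (\<integral>y. k x y * g y \<partial>\<rho>)"

lemma integrable_k_mult:
  assumes "integrable \<rho> g" "x \<in> X"
  shows "integrable \<rho> (\<lambda>y. k x y * g y)"
proof -
  obtain \<kappa> where \<kappa>: "0 < \<kappa>" "\<And>x y. x \<in> X \<Longrightarrow> y \<in> X \<Longrightarrow> \<bar>k x y\<bar> \<le> \<kappa>" using k_bounded by metis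
  show ?thesis
  proof (rule Bochner_Integration.integrable_bound)
    show "integrable \<rho> (\<lambda>y. \<kappa> * g y)" using assms by simp
    show "(\<lambda>y. k x y * g y) \<in> borel_measurable \<rho>"
      using cont_measurable[OF k_section_cont[OF assms(2)]] assms(1) by measurable
    show "AE y in \<rho>. norm (k x y * g y) \<le> norm (\<kappa> * g y)"
      using \<kappa> assms(2) by (intro AE_I2) (auto simp: abs_mult intro!: mult_right_mono)
  qed
qed

lemma Kop_diff_le:
  assumes g: "integrable \<rho> g" and "x \<in> X" "x' \<in> X" and "\<And>y. y \<in> X \<Longrightarrow> \<bar>k x y - k x' y\<bar> \<le> e"
  shows "\<bar>Kop g x - Kop g x'\<bar> \<le> e * (\<integral>y. \<bar>g y\<bar> \<partial>\<rho>)"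
proof -
  have "Kop g x - Kop g x' = (\<integral>y. k x y * g y - k x' y * g y \<partial>\<rho>)"
    unfolding Kop_def using assms by (simp add: integrable_k_mult)
  also have "\<bar>\<dots>\<bar> \<le> (\<integral>y. \<bar>k x y * g y - k x' y * g y\<bar> \<partial>\<rho>)" by (rule integral_abs_bound)
  also have "\<dots> \<le> (\<integral>y. e * \<bar>g y\<bar> \<partial>\<rho>)"
  proof (rule integral_mono)
    show "\<bar>k x y * g y - k x' y * g y\<bar> \<le> e * \<bar>g y\<bar>" if "y \<in> space \<rho>" for y
      using assms(4)[of y] that by (simp add: left_diff_distrib[symmetric] abs_mult mult_right_mono)
  qed (use assms in \<open>auto intro!: integrable_abs Bochner_Integration.integrable_diff integrable_k_mult\<close>)
  finally show ?thesis by simp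
qed

lemma Kop_bound:
  assumes g: "integrable \<rho> g" and "x \<in> X" and "\<And>y. y \<in> X \<Longrightarrow> \<bar>k x y\<bar> \<le> \<kappa>"
  shows "\<bar>Kop g x\<bar> \<le> \<kappa> * (\<integral>y. \<bar>g y\<bar> \<partial>\<rho>)"
proof -
  have "\<bar>Kop g x\<bar> \<le> (\<integral>y. \<bar>k x y * g y\<bar> \<partial>\<rho>)" unfolding Kop_def by (rule integral_abs_bound)
  also have "\<dots> \<le> (\<integral>y. \<kappa> * \<bar>g y\<bar> \<partial>\<rho>)"
  proof (rule integral_mono)
    show "\<bar>k x y * g y\<bar> \<le> \<kappa> * \<bar>g y\<bar>" if "y \<in> space \<rho>" for y
      using assms(3)[of y] that by (simp add: abs_mult mult_right_mono)
  qed (use assms in \<open>auto intro!: integrable_abs integrable_k_mult\<close>)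
  finally show ?thesis by simp
qed

lemma Kop_cont:
  assumes g: "integrable \<rho> g"
  shows "continuous_on X (Kop g)"
proof (unfold continuous_on_iff, intro ballI allI impI)
  fix x and e :: real assume x: "x \<in> X" and "e > 0"
  define G where "G = (\<integral>y. \<bar>g y\<bar> \<partial>\<rho>) + 1"
  have "(\<integral>y. \<bar>g y\<bar> \<partial>\<rho>) \<ge> 0" by simp
  then have G: "G > 0" "(\<integral>y. \<bar>g y\<bar> \<partial>\<rho>) < G" unfolding G_def by linarith+
  obtain d where d: "0 < d" "\<And>x x' y. x \<in> X \<Longrightarrow> x' \<in> X \<Longrightarrow> y \<in> X \<Longrightarrow> dist x x' < d \<Longrightarrow> \<bar>k x y - k x' y\<bar> < e / G"
    using k_equicont[of "e / G"] \<open>e > 0\<close> G by (metis divide_pos_pos)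
  have "dist (Kop g x') (Kop g x) < e" if "x' \<in> X" "dist x' x < d" for x'
  proof -
    have "\<bar>Kop g x' - Kop g x\<bar> \<le> e / G * (\<integral>y. \<bar>g y\<bar> \<partial>\<rho>)"
      using d(2)[OF that(1) x _ that(2)] x that by (intro Kop_diff_le[OF g]) (auto intro: less_imp_le)
    also have "\<dots> < e / G * G" using G \<open>e > 0\<close> by (intro mult_strict_left_mono) auto
    finally show ?thesis using G by (simp add: dist_real_def)
  qed
  then show "\<exists>d>0. \<forall>x'\<in>X. dist x' x < d \<longrightarrow> dist (Kop g x') (Kop g x) < e" using d(1) by blast
qed

lemma Kop_cont' [continuous_intros]: "continuous_on X g \<Longrightarrow> continuous_on X (Kop g)"
  by (intro Kop_cont cont_integrable)

lemma Kop_lincomb: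
  assumes "integrable \<rho> f" "integrable \<rho> g" "x \<in> X"
  shows "Kop (\<lambda>y. s * f y + t * g y) x = s * Kop f x + t * Kop g x"
proof -
  have "Kop (\<lambda>y. s * f y + t * g y) x = (\<integral>y. s * (k x y * f y) + t * (k x y * g y) \<partial>\<rho>)"
    unfolding Kop_def by (intro Bochner_Integration.integral_cong) (auto simp: algebra_simps)
  also have "\<dots> = s * Kop f x + t * Kop g x"
    unfolding Kop_def using integrable_k_mult[OF assms(1,3)] integrable_k_mult[OF assms(2,3)] by simp
  finally show ?thesis .
qed

lemma Kop_sum:
  assumes "\<And>i. i \<in> I \<Longrightarrow> integrable \<rho> (f i)" "x \<in> X"
  shows "Kop (\<lambda>y. \<Sum>i\<in>I. c i * f i y) x = (\<Sum>i\<in>I. c i * Kop (f i) x)"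
proof -
  have "Kop (\<lambda>y. \<Sum>i\<in>I. c i * f i y) x = (\<integral>y. (\<Sum>i\<in>I. c i * (k x y * f i y)) \<partial>\<rho>)"
    unfolding Kop_def by (intro Bochner_Integration.integral_cong) (auto simp: algebra_simps sum_distrib_left)
  also have "\<dots> = (\<Sum>i\<in>I. c i * Kop (f i) x)"
    unfolding Kop_def using assms by (subst Bochner_Integration.integral_sum) (auto simp: integrable_k_mult)
  finally show ?thesis .
qed

text \<open>Continuity of \<open>k\<close> is known only on the square of \<open>X\<close>, hence
  the extension by zero; \<open>borel_prod\<close> then identifies the Borel sets of the product
  with the product sigma-algebra.\<close>

lemma k_pair_measurable: "(\<lambda>(x, y). k x y) \<in> borel_measurable (\<rho> \<Otimes>\<^sub>M \<rho>)"
proof -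
  have XX: "X \<times> X \<in> sets borel" using closed_X by (intro borel_closed closed_Times)
  have id: "(\<lambda>x. x) \<in> measurable \<rho> borel" by (rule cont_measurable) (rule continuous_on_id)
  have "(\<lambda>z. indicator (X \<times> X) z *\<^sub>R k (fst z) (snd z)) \<in> borel_measurable borel"
    by (rule borel_measurable_continuous_on_indicator[OF XX k_cont])
  then have "(\<lambda>z. indicator (X \<times> X) z *\<^sub>R k (fst z) (snd z)) \<in> borel_measurable (borel \<Otimes>\<^sub>M borel)"
    by (simp add: borel_prod)
  moreover have "(\<lambda>z. (fst z, snd z)) \<in> measurable (\<rho> \<Otimes>\<^sub>M \<rho>) (borel \<Otimes>\<^sub>M borel)"
    using id by (intro measurable_Pair measurable_compose[OF measurable_fst] measurable_compose[OF measurable_snd])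
  ultimately have "(\<lambda>z. indicator (X \<times> X) z *\<^sub>R k (fst z) (snd z)) \<in> borel_measurable (\<rho> \<Otimes>\<^sub>M \<rho>)"
    by (auto dest: measurable_comp simp: comp_def)
  then show ?thesis
    by (rule measurable_cong[THEN iffD1, rotated]) (auto simp: space_pair_measure)
qed

lemma Kop_symmetric:
  assumes f: "continuous_on X f" and g: "continuous_on X g"
  shows "(\<integral>x. f x * Kop g x \<partial>\<rho>) = (\<integral>x. Kop f x * g x \<partial>\<rho>)"
proof -
  interpret P: pair_prob_space \<rho> \<rho> ..
  obtain \<kappa> where \<kappa>: "0 < \<kappa>" "\<And>x y. x \<in> X \<Longrightarrow> y \<in> X \<Longrightarrow> \<bar>k x y\<bar> \<le> \<kappa>" using k_bounded by metis
  obtain F where F: "0 < F" "\<And>x. x \<in> X \<Longrightarrow> \<bar>f x\<bar> \<le> F" using cont_bounded[OF f] by metis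
  obtain G where G: "0 < G" "\<And>x. x \<in> X \<Longrightarrow> \<bar>g x\<bar> \<le> G" using cont_bounded[OF g] by metis
  note [measurable] = cont_measurable[OF f] cont_measurable[OF g] k_pair_measurable
  have "integrable (\<rho> \<Otimes>\<^sub>M \<rho>) (\<lambda>(x, y). f x * k x y * g y)"
  proof (rule P.integrable_const_bound[of _ "F * \<kappa> * G"])
    show "AE z in \<rho> \<Otimes>\<^sub>M \<rho>. norm (case z of (x, y) \<Rightarrow> f x * k x y * g y) \<le> F * \<kappa> * G"
      using F G \<kappa> by (intro AE_I2) (auto simp: space_pair_measure abs_mult intro!: mult_mono)
  qed measurable
  from P.Fubini_integral[OF this]
  have "(\<integral>y. (\<integral>x. f x * k x y * g y \<partial>\<rho>) \<partial>\<rho>) = (\<integral>x. (\<integral>y. f x * k x y * g y \<partial>\<rho>) \<partial>\<rho>)" .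
  moreover have "(\<integral>y. f x * k x y * g y \<partial>\<rho>) = f x * Kop g x" for x
    by (simp add: Kop_def mult.assoc)
  moreover have "(\<integral>x. f x * k x y * g y \<partial>\<rho>) = Kop f y * g y" if "y \<in> X" for y
  proof -
    have "(\<integral>x. f x * k x y * g y \<partial>\<rho>) = (\<integral>x. (k y x * f x) * g y \<partial>\<rho>)"
      using that by (intro Bochner_Integration.integral_cong) (auto simp: k_sym)
    then show ?thesis by (simp add: Kop_def)
  qed
  ultimately show ?thesis
    by (metis (mono_tags, lifting) Bochner_Integration.integral_cong space_\<rho>)
qed

text \<open>
  The values are projected back to \<open>X\<close> by \<^const>\<open>closest_point\<close>, as positive definiteness of \<open>k\<close>
  is only available for points of \<open>X\<close>.
\<close>

lemma simple_approx_id: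
  obtains s :: "nat \<Rightarrow> 'x \<Rightarrow> 'x" where "\<And>n. simple_function \<rho> (s n)"
    "\<And>n x. x \<in> X \<Longrightarrow> s n x \<in> X" "\<And>x. x \<in> X \<Longrightarrow> (\<lambda>n. s n x) \<longlonglongrightarrow> x"
proof -
  have "(\<lambda>x. x) \<in> borel_measurable \<rho>" by (rule cont_measurable) (rule continuous_on_id)
  from borel_measurable_implies_sequence_metric[OF this]
  obtain F where F: "\<And>n. simple_function \<rho> (F n)" "\<And>x. x \<in> X \<Longrightarrow> (\<lambda>n. F n x) \<longlonglongrightarrow> x"
    by (metis space_\<rho>)
  define s where "s n x = closest_point X (F n x)" for n x
  show ?thesis
  proof
    show "simple_function \<rho> (s n)" for n
      using simple_function_compose[OF F(1), of "closest_point X" n] by (simp add: s_def[abs_def] comp_def)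
    show "s n x \<in> X" for n x
      unfolding s_def using closed_X X_nonempty by (rule closest_point_in_set)
    fix x assume x: "x \<in> X"
    have lim0: "(\<lambda>n. 2 * dist (F n x) x) \<longlonglongrightarrow> 0"
      by (rule tendsto_mult_right_zero[OF tendsto_dist_iff[THEN iffD1, OF F(2)[OF x]]])
    show "(\<lambda>n. s n x) \<longlonglongrightarrow> x"
    proof (rule tendsto_dist_iff[THEN iffD2], rule Lim_null_comparison[OF _ lim0], intro always_eventually allI)
      fix n
      have "dist (F n x) (s n x) \<le> dist (F n x) x"
        unfolding s_def by (rule closest_point_le[OF closed_X x])
      then show "norm (dist (s n x) x) \<le> 2 * dist (F n x) x"
        using dist_triangle[of "s n x" x "F n x"] dist_commute[of "s n x" "F n x"] by simp
    qed
  qed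
qed

section \<open>From positive definiteness on finite sets to positivity of the integral form\<close>

lemma integral_comp_simple:
  assumes s: "simple_function \<rho> s"
  shows "(\<integral>x. h (s x) \<partial>\<rho>) = (\<Sum>y\<in>s ` X. measure \<rho> (s -` {y} \<inter> X) * (h y :: real))"
proof -
  have fin: "finite (s ` X)" and meas: "\<And>y. s -` {y} \<inter> X \<in> sets \<rho>"
    using s simple_functionD[OF s] by (auto simp: Int_commute)
  have "(\<integral>x. h (s x) \<partial>\<rho>) = (\<integral>x. (\<Sum>y\<in>s ` X. indicator (s -` {y} \<inter> X) x * h y) \<partial>\<rho>)"
  proof (rule Bochner_Integration.integral_cong)
    fix x assume "x \<in> space \<rho>"
    then have "(\<Sum>y\<in>s ` X. indicator (s -` {y} \<inter> X) x * h y) = (\<Sum>y\<in>s ` X. if y = s x then h y else 0)"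
      by (intro sum.cong) (auto simp: indicator_def)
    then show "h (s x) = (\<Sum>y\<in>s ` X. indicator (s -` {y} \<inter> X) x * h y)"
      using \<open>x \<in> space \<rho>\<close> fin by simp
  qed simp
  also have "\<dots> = (\<Sum>y\<in>s ` X. measure \<rho> (s -` {y} \<inter> X) * h y)"
    using meas by (subst Bochner_Integration.integral_sum)
      (auto intro!: integrable_mult_left simp: less_top[symmetric])
  finally show ?thesis .
qed

text \<open>The image of \<open>\<rho>\<close> under \<open>s\<close> consists of finitely many
  point masses \<open>p y\<close>. The inequality is positive definiteness for the coefficients
  \<open>p y * u y\<close> at these points together with \<open>t\<close> at
  \<open>x\<close>.\<close>

lemma simple_psd:
  assumes s: "simple_function \<rho> s" "\<And>x. x \<in> X \<Longrightarrow> s x \<in> X" and x: "x \<in> X"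
  shows "0 \<le> t\<^sup>2 * k x x + 2 * t * (\<integral>y. k x (s y) * u (s y) \<partial>\<rho>)
    + (\<integral>z. u (s z) * (\<integral>y. k (s z) (s y) * u (s y) \<partial>\<rho>) \<partial>\<rho>)"
proof -
  define p where "p y = measure \<rho> (s -` {y} \<inter> X)" for y
  have fin: "finite (s ` X)" using simple_functionD(1)[OF s(1)] by simp
  then obtain ys where ys: "set ys = s ` X" "distinct ys" using finite_distinct_list by blast
  have ysX: "set ys \<subseteq> X" using s(2) ys by auto
  define cs where "cs = (t, x) # map (\<lambda>y. (p y * u y, y)) ys"
  have "set (map snd cs) \<subseteq> X" using ysX x by (auto simp: cs_def)
  then have "0 \<le> (\<Sum>(c,y)\<leftarrow>cs. \<Sum>(d,z)\<leftarrow>cs. c * d * k y z)"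
    using k_pd unfolding pd_kernel_on_def by blast
  also have "\<dots> = t * t * k x x + (\<Sum>z\<in>set ys. t * (p z * u z) * k x z)
      + (\<Sum>y\<in>set ys. p y * u y * t * k y x + (\<Sum>z\<in>set ys. p y * u y * (p z * u z) * k y z))"
    using ys(2) by (simp add: cs_def comp_def sum_list_distinct_conv_sum_set)
  also have "\<dots> = t\<^sup>2 * k x x + 2 * t * (\<Sum>z\<in>set ys. p z * (k x z * u z))
      + (\<Sum>y\<in>set ys. p y * (u y * (\<Sum>z\<in>set ys. p z * (k y z * u z))))"
  proof -
    have "(\<Sum>y\<in>set ys. p y * u y * t * k y x) = t * (\<Sum>z\<in>set ys. p z * (k x z * u z))"
      unfolding sum_distrib_left using ysX x by (intro sum.cong) (auto simp: k_sym)
    moreover have "(\<Sum>z\<in>set ys. t * (p z * u z) * k x z) = t * (\<Sum>z\<in>set ys. p z * (k x z * u z))"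
      unfolding sum_distrib_left by (intro sum.cong) auto
    moreover have "(\<Sum>y\<in>set ys. (\<Sum>z\<in>set ys. p y * u y * (p z * u z) * k y z)) =
        (\<Sum>y\<in>set ys. p y * (u y * (\<Sum>z\<in>set ys. p z * (k y z * u z))))"
      unfolding sum_distrib_left by (intro sum.cong refl) auto
    ultimately show ?thesis by (simp add: sum.distrib power2_eq_square)
  qed
  also have "\<dots> = t\<^sup>2 * k x x + 2 * t * (\<integral>y. k x (s y) * u (s y) \<partial>\<rho>)
    + (\<integral>z. u (s z) * (\<integral>y. k (s z) (s y) * u (s y) \<partial>\<rho>) \<partial>\<rho>)"
    unfolding integral_comp_simple[OF s(1), of "\<lambda>y. k _ y * u y"] p_def ys(1)
      integral_comp_simple[OF s(1), of "\<lambda>z. u z * (\<Sum>y\<in>s ` X. measure \<rho> (s -` {y} \<inter> X) * (k z y * u y))"] ..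
  finally show ?thesis .
qed

text \<open>Positive definiteness tested on the signed measure "\<open>t\<close> times the point
  mass at \<open>x\<close> plus \<open>u\<close> times \<open>\<rho>\<close>", as a limit of
  \<open>simple_psd\<close> along simple maps tending to the identity. The point mass is what later
  produces bounds by \<open>k x x\<close>; \<open>t = 0\<close> gives positivity of the
  operator.\<close>

lemma kernel_psd:
  assumes u: "continuous_on X u" and x: "x \<in> X"
  shows "0 \<le> t\<^sup>2 * k x x + 2 * t * Kop u x + (\<integral>z. u z * Kop u z \<partial>\<rho>)"
proof -
  obtain s where s: "\<And>n. simple_function \<rho> (s n)" "\<And>n x. x \<in> X \<Longrightarrow> s n x \<in> X"
    "\<And>x. x \<in> X \<Longrightarrow> (\<lambda>n. s n x) \<longlonglongrightarrow> x" using simple_approx_id by blast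
  obtain \<kappa> where \<kappa>: "0 < \<kappa>" "\<And>x y. x \<in> X \<Longrightarrow> y \<in> X \<Longrightarrow> \<bar>k x y\<bar> \<le> \<kappa>" using k_bounded by metis
  obtain U where U: "0 < U" "\<And>x. x \<in> X \<Longrightarrow> \<bar>u x\<bar> \<le> U" using cont_bounded[OF u] by metis
  have ms: "(\<lambda>y. h (s n y)) \<in> borel_measurable \<rho>" for n and h :: "'x \<Rightarrow> real"
    using borel_measurable_simple_function[OF simple_function_compose[OF s(1), of h n]] by (simp add: comp_def)
  \<comment> \<open>The first argument of \<open>k\<close> moves with \<open>n\<close> because the
    outer variable is also replaced by \<open>s n z\<close>; joint continuity of \<open>k\<close>
    absorbs this. A constant sequence covers the term at \<open>x\<close>.\<close>
  have inner_lim: "(\<lambda>n. \<integral>y. k (zn n) (s n y) * u (s n y) \<partial>\<rho>) \<longlonglongrightarrow> Kop u z"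
    if z: "z \<in> X" and zn: "\<And>n. zn n \<in> X" "zn \<longlonglongrightarrow> z" for zn z
    unfolding Kop_def
  proof (rule integral_dominated_convergence[where w = "\<lambda>_. \<kappa> * U"])
    show "(\<lambda>y. k z y * u y) \<in> borel_measurable \<rho>"
      by (intro cont_measurable continuous_intros k_section_cont z u)
    show "(\<lambda>y. k (zn n) (s n y) * u (s n y)) \<in> borel_measurable \<rho>" for n
      by (rule ms[of "\<lambda>y. k (zn n) y * u y"])
    show "integrable \<rho> (\<lambda>_. \<kappa> * U)" by simp
    show "AE y in \<rho>. norm (k (zn n) (s n y) * u (s n y)) \<le> \<kappa> * U" for n
      using s(2) zn \<kappa> U by (intro AE_I2) (auto simp: abs_mult intro!: mult_mono)
    show "AE y in \<rho>. (\<lambda>n. k (zn n) (s n y) * u (s n y)) \<longlonglongrightarrow> k z y * u y"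
    proof (intro AE_I2 tendsto_mult)
      fix y assume "y \<in> space \<rho>"
      then have y: "y \<in> X" by simp
      show "(\<lambda>n. u (s n y)) \<longlonglongrightarrow> u y"
        using continuous_on_tendsto_compose[OF u s(3)[OF y] y] s(2) y by simp
      show "(\<lambda>n. k (zn n) (s n y)) \<longlonglongrightarrow> k z y"
        using continuous_on_tendsto_compose[OF k_cont tendsto_Pair[OF zn(2) s(3)[OF y]]] s(2) y z zn by simp
    qed
  qed
  have ib: "\<bar>\<integral>y. k z (s n y) * u (s n y) \<partial>\<rho>\<bar> \<le> \<kappa> * U" if "z \<in> X" for z n
  proof -
    have b: "\<bar>k z (s n y) * u (s n y)\<bar> \<le> \<kappa> * U" if "y \<in> X" for y
      using \<kappa> U s(2) that \<open>z \<in> X\<close> by (auto simp: abs_mult intro!: mult_mono)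
    have i: "integrable \<rho> (\<lambda>y. k z (s n y) * u (s n y))"
      by (rule integrable_of_bound[OF ms[of "\<lambda>y. k z y * u y"] b])
    have "\<bar>\<integral>y. k z (s n y) * u (s n y) \<partial>\<rho>\<bar> \<le> (\<integral>y. \<bar>k z (s n y) * u (s n y)\<bar> \<partial>\<rho>)" by (rule integral_abs_bound)
    also have "\<dots> \<le> \<kappa> * U" by (intro integral_le_const integrable_abs i b)
    finally show ?thesis .
  qed
  have "(\<lambda>n. \<integral>z. u (s n z) * (\<integral>y. k (s n z) (s n y) * u (s n y) \<partial>\<rho>) \<partial>\<rho>) \<longlonglongrightarrow> (\<integral>z. u z * Kop u z \<partial>\<rho>)"
  proof (rule integral_dominated_convergence[where w = "\<lambda>_. U * (\<kappa> * U)"])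
    show "(\<lambda>z. u z * Kop u z) \<in> borel_measurable \<rho>"
      by (intro cont_measurable continuous_intros u)
    show "(\<lambda>z. u (s n z) * (\<integral>y. k (s n z) (s n y) * u (s n y) \<partial>\<rho>)) \<in> borel_measurable \<rho>" for n
      by (rule ms[of "\<lambda>z. u z * (\<integral>y. k z (s n y) * u (s n y) \<partial>\<rho>)"])
    show "integrable \<rho> (\<lambda>_. U * (\<kappa> * U))" by simp
    show "AE z in \<rho>. norm (u (s n z) * (\<integral>y. k (s n z) (s n y) * u (s n y) \<partial>\<rho>)) \<le> U * (\<kappa> * U)" for n
      using s(2) U \<kappa>(1) ib by (intro AE_I2) (auto simp: abs_mult intro!: mult_mono)
    show "AE z in \<rho>. (\<lambda>n. u (s n z) * (\<integral>y. k (s n z) (s n y) * u (s n y) \<partial>\<rho>)) \<longlonglongrightarrow> u z * Kop u z"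
    proof (intro AE_I2 tendsto_mult)
      fix z assume "z \<in> space \<rho>"
      then have z: "z \<in> X" by simp
      show "(\<lambda>n. u (s n z)) \<longlonglongrightarrow> u z"
        using continuous_on_tendsto_compose[OF u s(3)[OF z] z] s(2) z by simp
      show "(\<lambda>n. \<integral>y. k (s n z) (s n y) * u (s n y) \<partial>\<rho>) \<longlonglongrightarrow> Kop u z"
        by (rule inner_lim[OF z]) (use s z in auto)
    qed
  qed
  moreover have "(\<lambda>n. \<integral>y. k x (s n y) * u (s n y) \<partial>\<rho>) \<longlonglongrightarrow> Kop u x"
    by (rule inner_lim[OF x]) (use x in auto)
  ultimately have "(\<lambda>n. t\<^sup>2 * k x x + 2 * t * (\<integral>y. k x (s n y) * u (s n y) \<partial>\<rho>)
      + (\<integral>z. u (s n z) * (\<integral>y. k (s n z) (s n y) * u (s n y) \<partial>\<rho>) \<partial>\<rho>))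
    \<longlonglongrightarrow> t\<^sup>2 * k x x + 2 * t * Kop u x + (\<integral>z. u z * Kop u z \<partial>\<rho>)"
    by (intro tendsto_intros)
  then show ?thesis
    by (rule tendsto_lowerbound) (auto intro!: always_eventually simple_psd s x)
qed

end

section \<open>Mercer's theorem\<close>

context compact_kernel
begin

section \<open>Inner products of continuous functions in L^2 and in the form defined by the
  operator\<close>

lemma cont_mult_integrable:
  "continuous_on X f \<Longrightarrow> continuous_on X g \<Longrightarrow> integrable \<rho> (\<lambda>x. f x * g x :: real)"
  by (intro cont_integrable continuous_intros)

lemma integral_lincomb_mult:
  assumes "continuous_on X f" "continuous_on X g" "continuous_on X h"
  shows "(\<integral>x. (s * f x + t * g x) * h x \<partial>\<rho>) = s * (\<integral>x. f x * h x \<partial>\<rho>) + t * (\<integral>x. g x * h x \<partial>\<rho> :: real)"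
proof -
  have "(\<integral>x. (s * f x + t * g x) * h x \<partial>\<rho>) = (\<integral>x. s * (f x * h x) + t * (g x * h x) \<partial>\<rho>)"
    by (simp add: algebra_simps)
  then show ?thesis using assms by (simp add: cont_mult_integrable)
qed

lemma integral_square_lincomb:
  assumes "continuous_on X f" "continuous_on X g"
  shows "(\<integral>x. (s * f x + t * g x) * (s * f x + t * g x) \<partial>\<rho>)
    = s\<^sup>2 * (\<integral>x. f x * f x \<partial>\<rho>) + 2 * s * t * (\<integral>x. f x * g x \<partial>\<rho>) + t\<^sup>2 * (\<integral>x. g x * g x \<partial>\<rho> :: real)"
proof -
  have "(\<integral>x. (s * f x + t * g x) * (s * f x + t * g x) \<partial>\<rho>)
    = (\<integral>x. s\<^sup>2 * (f x * f x) + 2 * s * t * (f x * g x) + t\<^sup>2 * (g x * g x) \<partial>\<rho>)"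
    by (simp add: algebra_simps power2_eq_square)
  then show ?thesis using assms by (simp add: cont_mult_integrable)
qed

lemma Cauchy_Schwarz_integral:
  assumes "continuous_on X f" "continuous_on X g"
  shows "(\<integral>x. f x * g x \<partial>\<rho>)\<^sup>2 \<le> (\<integral>x. f x * f x \<partial>\<rho>) * (\<integral>x. g x * g x \<partial>\<rho> :: real)"
proof (rule nonneg_quadratic_discriminant)
  fix t :: real
  have "0 \<le> (\<integral>x. (t * f x + 1 * g x) * (t * f x + 1 * g x) \<partial>\<rho>)" by (rule Bochner_Integration.integral_nonneg) simp
  then show "0 \<le> (\<integral>x. f x * f x \<partial>\<rho>) * t\<^sup>2 + 2 * (\<integral>x. f x * g x \<partial>\<rho>) * t + (\<integral>x. g x * g x \<partial>\<rho>)"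
    unfolding integral_square_lincomb[OF assms] by (simp add: algebra_simps)
qed

lemma integral_abs_le_L2:
  assumes "continuous_on X (g :: 'x \<Rightarrow> real)"
  shows "(\<integral>x. \<bar>g x\<bar> \<partial>\<rho>) \<le> sqrt (\<integral>x. g x * g x \<partial>\<rho>)"
  using Cauchy_Schwarz_integral[of "\<lambda>x. \<bar>g x\<bar>" "\<lambda>_. 1"] assms
  by (intro real_le_rsqrt) (simp add: continuous_intros)

lemma Kop_form_nonneg: "continuous_on X u \<Longrightarrow> 0 \<le> (\<integral>x. u x * Kop u x \<partial>\<rho>)"
  using kernel_psd[of u _ 0] X_nonempty by auto

text \<open>The form is symmetric and semidefinite. The inequality is used with
  \<open>f = Kop g\<close>, where it turns a bound on the form at \<open>g\<close> into a bound on
  the L^2 norm of \<open>Kop g\<close>.\<close>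

lemma Cauchy_Schwarz_Kop:
  assumes f: "continuous_on X f" and g: "continuous_on X g"
  shows "(\<integral>x. f x * Kop g x \<partial>\<rho>)\<^sup>2 \<le> (\<integral>x. f x * Kop f x \<partial>\<rho>) * (\<integral>x. g x * Kop g x \<partial>\<rho>)"
proof (rule nonneg_quadratic_discriminant)
  fix t :: real
  note c = f g Kop_cont'[OF f] Kop_cont'[OF g]
  have "0 \<le> (\<integral>x. (t * f x + 1 * g x) * Kop (\<lambda>x. t * f x + 1 * g x) x \<partial>\<rho>)"
    by (intro Kop_form_nonneg continuous_intros f g)
  also have "\<dots> = (\<integral>x. (t * f x + 1 * g x) * (t * Kop f x + 1 * Kop g x) \<partial>\<rho>)"
    using f g by (intro Bochner_Integration.integral_cong arg_cong2[where f = times] Kop_lincomb cont_integrable) auto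
  also have "\<dots> = (\<integral>x. t\<^sup>2 * (f x * Kop f x) + t * (f x * Kop g x) + t * (Kop f x * g x) + g x * Kop g x \<partial>\<rho>)"
    by (simp add: algebra_simps power2_eq_square)
  also have "\<dots> = t\<^sup>2 * (\<integral>x. f x * Kop f x \<partial>\<rho>) + t * (\<integral>x. f x * Kop g x \<partial>\<rho>)
      + t * (\<integral>x. Kop f x * g x \<partial>\<rho>) + (\<integral>x. g x * Kop g x \<partial>\<rho>)"
    using c by (simp add: cont_mult_integrable)
  finally show "0 \<le> (\<integral>x. f x * Kop f x \<partial>\<rho>) * t\<^sup>2 + 2 * (\<integral>x. f x * Kop g x \<partial>\<rho>) * t + (\<integral>x. g x * Kop g x \<partial>\<rho>)"
    unfolding Kop_symmetric[OF f g, symmetric] by (simp add: algebra_simps)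
qed

lemma uniform_limit_integral:
  assumes F: "\<And>n. continuous_on X (F n)" and u: "continuous_on X u" and h: "continuous_on X h"
    and lim: "uniform_limit X F u sequentially"
  shows "(\<lambda>n. \<integral>x. F n x * h x \<partial>\<rho>) \<longlonglongrightarrow> (\<integral>x. u x * h x \<partial>\<rho> :: real)"
proof -
  obtain B where B: "0 < B" "\<And>x. x \<in> X \<Longrightarrow> \<bar>h x\<bar> \<le> B" using cont_bounded[OF h] by metis
  show ?thesis
  proof (rule LIMSEQ_I)
    fix e :: real assume "e > 0"
    have "e / (2 * B) > 0" using \<open>e > 0\<close> B by simp
    from uniform_limitD[OF lim this] obtain N
      where N: "\<And>n x. n \<ge> N \<Longrightarrow> x \<in> X \<Longrightarrow> \<bar>F n x - u x\<bar> < e / (2 * B)"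
      by (auto simp: eventually_sequentially dist_real_def)
    have "norm ((\<integral>x. F n x * h x \<partial>\<rho>) - (\<integral>x. u x * h x \<partial>\<rho>)) < e" if "n \<ge> N" for n
    proof -
      have "(\<integral>x. F n x * h x \<partial>\<rho>) - (\<integral>x. u x * h x \<partial>\<rho>) = (\<integral>x. F n x * h x - u x * h x \<partial>\<rho>)"
        using F u h by (simp add: cont_mult_integrable)
      also have "\<bar>\<dots>\<bar> \<le> (\<integral>x. \<bar>F n x * h x - u x * h x\<bar> \<partial>\<rho>)" by (rule integral_abs_bound)
      also have "\<dots> \<le> e / 2"
      proof (rule integral_le_const)
        show "integrable \<rho> (\<lambda>x. \<bar>F n x * h x - u x * h x\<bar>)"
          by (intro cont_integrable continuous_intros F u h)
        fix x assume x: "x \<in> X"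
        have "\<bar>F n x * h x - u x * h x\<bar> = \<bar>F n x - u x\<bar> * \<bar>h x\<bar>" by (simp add: abs_mult left_diff_distrib[symmetric])
        also have "\<dots> \<le> e / (2 * B) * B" using N[OF that x] B(2)[OF x] B(1) \<open>e > 0\<close> by (intro mult_mono) auto
        finally show "\<bar>F n x * h x - u x * h x\<bar> \<le> e / 2" using B(1) by simp
      qed
      finally show ?thesis using \<open>e > 0\<close> by simp
    qed
    then show "\<exists>N. \<forall>n\<ge>N. norm ((\<integral>x. F n x * h x \<partial>\<rho>) - (\<integral>x. u x * h x \<partial>\<rho>)) < e" by blast
  qed
qed

end

text \<open>Eigenfunctions in their continuous versions, with the eigenvalue equation at every
  point. \<open>e_complete\<close> expresses that the list exhausts the positive eigenvalues with
  multiplicity: a further eigenfunction could be made orthogonal to all listed ones. It is stated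
  for continuous \<open>g\<close> only, since an eigenfunction with nonzero eigenvalue has a
  continuous version.\<close>

locale mercer_kernel = compact_kernel X k \<rho>
  for X :: "'x::euclidean_space set" and k \<rho> +
  fixes lam :: "nat \<Rightarrow> real" and e :: "nat \<Rightarrow> 'x \<Rightarrow> real"
  assumes lam_pos: "\<And>i. lam i > 0"
    and e_cont: "\<And>i. continuous_on X (e i)"
    and e_orth: "\<And>i j. (\<integral>x. e i x * e j x \<partial>\<rho>) = (if i = j then 1 else 0)"
    and e_eig: "\<And>i x. x \<in> X \<Longrightarrow> Kop (e i) x = lam i * e i x"
    and e_complete: "\<And>m g x. m > 0 \<Longrightarrow> continuous_on X g \<Longrightarrow> (\<And>x. x \<in> X \<Longrightarrow> Kop g x = m * g x) \<Longrightarrow>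
      (\<And>i. (\<integral>x. g x * e i x \<partial>\<rho>) = 0) \<Longrightarrow> x \<in> X \<Longrightarrow> g x = 0"
begin

lemma integral_sum_e_mult:
  assumes "continuous_on X g"
  shows "(\<integral>x. (\<Sum>i\<in>I. c i * e i x) * g x \<partial>\<rho>) = (\<Sum>i\<in>I. c i * (\<integral>x. e i x * g x \<partial>\<rho>))"
proof -
  have "(\<integral>x. (\<Sum>i\<in>I. c i * e i x) * g x \<partial>\<rho>) = (\<integral>x. (\<Sum>i\<in>I. c i * (e i x * g x)) \<partial>\<rho>)"
    by (simp add: sum_distrib_right mult.assoc)
  then show ?thesis using e_cont assms by (simp add: cont_mult_integrable)
qed

lemma integral_sum_e_sum_e:
  assumes "finite I"
  shows "(\<integral>x. (\<Sum>i\<in>I. c i * e i x) * (\<Sum>j\<in>I. d j * e j x) \<partial>\<rho>) = (\<Sum>i\<in>I. c i * d i)"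
proof -
  have "(\<integral>x. e i x * (\<Sum>j\<in>I. d j * e j x) \<partial>\<rho>) = d i" if "i \<in> I" for i
  proof -
    have "(\<integral>x. e i x * (\<Sum>j\<in>I. d j * e j x) \<partial>\<rho>) = (\<Sum>j\<in>I. d j * (\<integral>x. e j x * e i x \<partial>\<rho>))"
      using integral_sum_e_mult[OF e_cont[of i], of d I] by (simp add: mult.commute)
    also have "\<dots> = d i" using assms that by (simp add: e_orth if_distrib cong: if_cong)
    finally show ?thesis .
  qed
  then show ?thesis
    by (subst integral_sum_e_mult) (auto intro!: continuous_intros e_cont)
qed

text \<open>Let \<open>u\<close> be the sum of \<open>e i x * e i\<close> and S the left-hand side.
  Both \<open>Kop u x\<close> and the form at \<open>u\<close> equal S, so \<open>kernel_psd\<close>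
  with \<open>t = -1\<close> reads \<open>k x x\<close> - 2 S + S \<ge> 0.\<close>

lemma kernel_Bessel:
  assumes x: "x \<in> X"
  shows "(\<Sum>i<n. lam i * (e i x)\<^sup>2) \<le> k x x"
proof -
  define u where "u = (\<lambda>y. \<Sum>i<n. e i x * e i y)"
  have u: "continuous_on X u" unfolding u_def by (intro continuous_intros e_cont)
  have Ku: "Kop u y = (\<Sum>i<n. (e i x * lam i) * e i y)" if "y \<in> X" for y
    unfolding u_def using that by (subst Kop_sum) (auto simp: cont_integrable e_cont e_eig mult.assoc)
  have "(\<integral>y. u y * Kop u y \<partial>\<rho>) = (\<integral>y. u y * (\<Sum>i<n. (e i x * lam i) * e i y) \<partial>\<rho>)"
    using Ku by (intro Bochner_Integration.integral_cong) auto
  also have "\<dots> = (\<Sum>i<n. lam i * (e i x)\<^sup>2)"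
    unfolding u_def by (subst integral_sum_e_sum_e) (auto simp: power2_eq_square algebra_simps)
  finally have "(\<integral>y. u y * Kop u y \<partial>\<rho>) = (\<Sum>i<n. lam i * (e i x)\<^sup>2)" .
  moreover have "Kop u x = (\<Sum>i<n. lam i * (e i x)\<^sup>2)"
    using Ku[OF x] by (simp add: power2_eq_square algebra_simps)
  ultimately show ?thesis using kernel_psd[OF u x, of "-1"] by simp
qed

section \<open>The continuous functions orthogonal to all eigenfunctions; the operator vanishes on
  them\<close>

definition V :: "('x \<Rightarrow> real) set" where
  "V = {g. continuous_on X g \<and> (\<forall>i. (\<integral>x. g x * e i x \<partial>\<rho>) = 0)}"

lemma Kop_V: assumes "g \<in> V" shows "Kop g \<in> V"
proof -
  have g: "continuous_on X g" and z: "\<And>i. (\<integral>x. g x * e i x \<partial>\<rho>) = 0" using assms by (auto simp: V_def)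
  have "(\<integral>x. Kop g x * e i x \<partial>\<rho>) = 0" for i
  proof -
    have "(\<integral>x. Kop g x * e i x \<partial>\<rho>) = (\<integral>x. g x * Kop (e i) x \<partial>\<rho>)" by (rule Kop_symmetric[OF g e_cont, symmetric])
    also have "\<dots> = (\<integral>x. lam i * (g x * e i x) \<partial>\<rho>)"
      by (intro Bochner_Integration.integral_cong) (auto simp: e_eig)
    finally show ?thesis by (simp add: z)
  qed
  then show ?thesis using g by (simp add: V_def Kop_cont')
qed

lemma V_lincomb:
  assumes "f \<in> V" "g \<in> V" shows "(\<lambda>x. s * f x + t * g x) \<in> V"
  using assms e_cont by (auto simp: V_def integral_lincomb_mult intro!: continuous_intros)

text \<open>
  If the form were not zero on \<open>V\<close>, Arzela-Ascoli would turn a maximising sequence on the unit ball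
  of \<open>V\<close> into an eigenfunction in \<open>V\<close> with positive eigenvalue, contradicting \<open>e_complete\<close>.
\<close>

lemma Kop_form_V:
  assumes g0: "g0 \<in> V"
  shows "(\<integral>x. g0 x * Kop g0 x \<partial>\<rho>) = 0"
proof (rule ccontr)
  assume nz: "(\<integral>x. g0 x * Kop g0 x \<partial>\<rho>) \<noteq> 0"
  define Q where "Q g = (\<integral>x. g x * Kop g x \<partial>\<rho>)" for g
  define W where "W = {g \<in> V. (\<integral>x. g x * g x \<partial>\<rho>) \<le> 1}"
  obtain \<kappa> where \<kappa>: "0 < \<kappa>" "\<And>x y. x \<in> X \<Longrightarrow> y \<in> X \<Longrightarrow> \<bar>k x y\<bar> \<le> \<kappa>" using k_bounded by metis
  have Vc: "continuous_on X g" if "g \<in> V" for g using that by (simp add: V_def)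
  have Wc: "continuous_on X g" if "g \<in> W" for g using that by (simp add: V_def W_def)
  have W1: "(\<integral>x. \<bar>g x\<bar> \<partial>\<rho>) \<le> 1" if "g \<in> W" for g
    using integral_abs_le_L2[OF Wc[OF that]] that by (simp add: W_def) (smt (verit) real_sqrt_le_1_iff)
  \<comment> \<open>Functions in \<open>W\<close> have L^1 norm at most 1, so the form is controlled
    by the sup norm of \<open>Kop g\<close>. This makes the supremum \<open>m\<close> finite and
    later yields the contradiction.\<close>
  have form_le: "Q g \<le> B" if g: "g \<in> W" and B: "\<And>x. x \<in> X \<Longrightarrow> \<bar>Kop g x\<bar> \<le> B" for g B
  proof -
    have B0: "B \<ge> 0" using B X_nonempty by (metis abs_ge_zero ex_in_conv order_trans)
    have "Q g \<le> (\<integral>x. B * \<bar>g x\<bar> \<partial>\<rho>)"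
      unfolding Q_def
    proof (rule integral_mono)
      fix x assume "x \<in> space \<rho>"
      have "g x * Kop g x \<le> \<bar>g x\<bar> * \<bar>Kop g x\<bar>" by (metis abs_ge_self abs_mult)
      also have "\<dots> \<le> B * \<bar>g x\<bar>" using mult_left_mono[OF B[of x], of "\<bar>g x\<bar>"] \<open>x \<in> space \<rho>\<close> by (simp add: mult.commute)
      finally show "g x * Kop g x \<le> B * \<bar>g x\<bar>" .
    qed (intro cont_integrable continuous_intros Wc g)+
    also have "\<dots> \<le> B * 1" using W1[OF g] B0 by (simp add: mult_left_le)
    finally show ?thesis by simp
  qed
  have Kb: "\<bar>Kop g x\<bar> \<le> \<kappa>" if "g \<in> W" "x \<in> X" for g x
  proof -
    have "\<bar>Kop g x\<bar> \<le> \<kappa> * (\<integral>y. \<bar>g y\<bar> \<partial>\<rho>)" using \<kappa>(2) that by (intro Kop_bound cont_integrable Wc) auto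
    also have "\<dots> \<le> \<kappa> * 1" using W1[OF that(1)] \<kappa>(1) by (intro mult_left_mono) auto
    finally show ?thesis by simp
  qed
  define m where "m = Sup (Q ` W)"
  have bdd: "bdd_above (Q ` W)" using form_le Kb by (intro bdd_aboveI[of _ \<kappa>]) auto
  have Wm: "Q g \<le> m" if "g \<in> W" for g unfolding m_def using that bdd by (intro cSUP_upper) auto
  have Vm: "Q g \<le> m * (\<integral>x. g x * g x \<partial>\<rho>)" if g: "g \<in> V" for g
  proof (cases "(\<integral>x. g x * g x \<partial>\<rho>) = 0")
    case True
    then have "g x = 0" if "x \<in> X" for x using integral_square_zero[OF Vc[OF g] _ that] by simp
    then have "Q g = (\<integral>x. 0 \<partial>\<rho>)" unfolding Q_def by (intro Bochner_Integration.integral_cong) auto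
    then show ?thesis using True by simp
  next
    case False
    define N where "N = (\<integral>x. g x * g x \<partial>\<rho>)"
    have "N \<ge> 0" unfolding N_def by (rule Bochner_Integration.integral_nonneg) simp
    then have N: "N > 0" using False unfolding N_def by linarith
    define c where "c = 1 / sqrt N"
    have c2: "c * c * N = 1" using N by (simp add: c_def)
    have "(\<lambda>x. c * g x + 0 * g x) \<in> V" by (rule V_lincomb[OF g g])
    then have cV: "(\<lambda>x. c * g x) \<in> V" by simp
    have "(\<integral>x. (c * g x) * (c * g x) \<partial>\<rho>) = (\<integral>x. c * c * (g x * g x) \<partial>\<rho>)" by (simp add: algebra_simps)
    also have "\<dots> = c * c * N" by (simp add: N_def)
    finally have cW: "(\<lambda>x. c * g x) \<in> W" using cV c2 by (simp add: W_def)
    have "Kop (\<lambda>y. c * g y) x = c * Kop g x" for x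
      unfolding Kop_def by (simp add: mult.left_commute)
    then have "Q (\<lambda>x. c * g x) = (\<integral>x. c * c * (g x * Kop g x) \<partial>\<rho>)"
      unfolding Q_def by (simp add: algebra_simps)
    then have "c * c * Q g \<le> m" using Wm[OF cW] by (simp add: Q_def)
    then have "N * (c * c * Q g) \<le> N * m" using N by (intro mult_left_mono) auto
    moreover have "N * (c * c * Q g) = Q g" using c2 by (metis mult.assoc mult.commute mult_1)
    ultimately have "Q g \<le> m * N" by (simp only: mult.commute[of N m])
    then show ?thesis unfolding N_def .
  qed
  have Q0: "Q g \<ge> 0" if "g \<in> V" for g unfolding Q_def by (rule Kop_form_nonneg[OF Vc[OF that]])
  have m0: "m > 0"
  proof (rule ccontr)
    assume "\<not> m > 0"
    moreover have "(\<integral>x. g0 x * g0 x \<partial>\<rho>) \<ge> 0" by (rule Bochner_Integration.integral_nonneg) simp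
    ultimately have "m * (\<integral>x. g0 x * g0 x \<partial>\<rho>) \<le> 0" by (simp add: mult_nonpos_nonneg)
    then show False using Vm[OF g0] Q0[OF g0] nz by (simp add: Q_def)
  qed
  \<comment> \<open>With B the squared norm of \<open>Kop g\<close>, Cauchy-Schwarz for the form and
    maximality of \<open>m\<close> at \<open>Kop g\<close> give B^2 \<le> m * B * Q g; then B
    cancels.\<close>
  have Kn: "(\<integral>x. Kop g x * Kop g x \<partial>\<rho>) \<le> m * Q g" if g: "g \<in> V" for g
  proof -
    define B where "B = (\<integral>x. Kop g x * Kop g x \<partial>\<rho>)"
    have B0: "B \<ge> 0" unfolding B_def by (rule Bochner_Integration.integral_nonneg) simp
    have "B\<^sup>2 \<le> Q (Kop g) * Q g"
      unfolding B_def Q_def by (rule Cauchy_Schwarz_Kop) (intro continuous_intros Vc g)+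
    also have "\<dots> \<le> m * B * Q g"
      using Vm[OF Kop_V[OF g]] Q0[OF g] unfolding B_def by (intro mult_right_mono) auto
    finally have "B * B \<le> B * (m * Q g)" by (simp add: power2_eq_square algebra_simps)
    then show ?thesis using B0 Q0[OF g] m0 unfolding B_def[symmetric]
      by (cases "B = 0") auto
  qed
  have "\<exists>g\<in>W. m - 1 / real (Suc n) < Q g" for n
  proof -
    have "(\<lambda>x. 0 * g0 x + 0 * g0 x) \<in> V" by (rule V_lincomb[OF g0 g0])
    then have "Q ` W \<noteq> {}" by (auto simp: W_def)
    moreover have "m - 1 / real (Suc n) < Sup (Q ` W)" by (simp add: m_def)
    ultimately show ?thesis using less_cSupD[of "Q ` W"] by blast
  qed
  then obtain g where gW: "\<And>n. g n \<in> W" and gm: "\<And>n. m - 1 / real (Suc n) < Q (g n)" by metis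
  have gV: "g n \<in> V" for n using gW[of n] by (simp add: W_def)
  \<comment> \<open>The residual of the eigenvalue equation. By \<open>Kn\<close> its squared norm
    is at most \<open>m * (m - Q (g n))\<close>, so maximising functions are approximate
    eigenfunctions.\<close>
  define f where "f n x = 1 * Kop (g n) x + (- m) * g n x" for n x
  have fc: "continuous_on X (f n)" for n unfolding f_def by (intro continuous_intros Vc gV)
  have f2: "(\<integral>x. f n x * f n x \<partial>\<rho>) \<le> m * (1 / real (Suc n))" for n
  proof -
    have "(\<integral>x. f n x * f n x \<partial>\<rho>) = (\<integral>x. Kop (g n) x * Kop (g n) x \<partial>\<rho>) - 2 * m * (\<integral>x. Kop (g n) x * g n x \<partial>\<rho>)
        + m\<^sup>2 * (\<integral>x. g n x * g n x \<partial>\<rho>)"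
      unfolding f_def by (subst integral_square_lincomb) (auto intro!: Vc gV Kop_V)
    moreover have "(\<integral>x. Kop (g n) x * g n x \<partial>\<rho>) = Q (g n)" by (simp add: Q_def mult.commute)
    moreover have "m\<^sup>2 * (\<integral>x. g n x * g n x \<partial>\<rho>) \<le> m\<^sup>2 * 1" using gW[of n] by (intro mult_left_mono) (auto simp: W_def)
    ultimately have "(\<integral>x. f n x * f n x \<partial>\<rho>) \<le> m * (m - Q (g n))"
      using Kn[OF gV[of n]] by (simp add: algebra_simps power2_eq_square)
    also have "\<dots> \<le> m * (1 / real (Suc n))" using gm[of n] m0 by (intro mult_left_mono) auto
    finally show ?thesis .
  qed
  \<comment> \<open>The functions \<open>g n\<close> themselves need not have a convergent
    subsequence; their images under \<open>Kop\<close> are uniformly bounded and equicontinuous, so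
    the candidate eigenfunction is a limit of images.\<close>
  obtain u r where u: "continuous_on X u" and r: "strict_mono (r :: nat \<Rightarrow> nat)"
    and ur: "\<And>\<epsilon>. 0 < \<epsilon> \<Longrightarrow> \<exists>N. \<forall>n x. n \<ge> N \<and> x \<in> X \<longrightarrow> norm (Kop (g (r n)) x - u x) < \<epsilon>"
  proof (rule Arzela_Ascoli[OF compact_X, of "\<lambda>n. Kop (g n)" \<kappa>])
    show "norm (Kop (g n) x) \<le> \<kappa>" if "x \<in> X" for n x using Kb[OF gW that] by simp
    fix x and \<epsilon> :: real assume x: "x \<in> X" and "0 < \<epsilon>"
    then obtain d where d: "0 < d" "\<And>x x' y. x \<in> X \<Longrightarrow> x' \<in> X \<Longrightarrow> y \<in> X \<Longrightarrow> dist x x' < d \<Longrightarrow> \<bar>k x y - k x' y\<bar> < \<epsilon> / 2"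
      using k_equicont[of "\<epsilon> / 2"] by (metis half_gt_zero)
    have "norm (Kop (g n) x - Kop (g n) y) < \<epsilon>" if y: "y \<in> X" "norm (x - y) < d" for n y
    proof -
      have "\<bar>Kop (g n) x - Kop (g n) y\<bar> \<le> \<epsilon> / 2 * (\<integral>y. \<bar>g n y\<bar> \<partial>\<rho>)"
        using d(2)[OF x y(1)] y x by (intro Kop_diff_le cont_integrable Vc gV) (auto simp: dist_norm intro: less_imp_le)
      also have "\<dots> \<le> \<epsilon> / 2 * 1" using W1[OF gW] \<open>0 < \<epsilon>\<close> by (intro mult_left_mono) auto
      finally show ?thesis using \<open>0 < \<epsilon>\<close> by simp
    qed
    then show "\<exists>d>0. \<forall>n y. y \<in> X \<and> norm (x - y) < d \<longrightarrow> norm (Kop (g n) x - Kop (g n) y) < \<epsilon>"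
      using d(1) by blast
  qed blast
  have ul: "uniform_limit X (\<lambda>n. Kop (g (r n))) u sequentially"
    unfolding uniform_limit_iff eventually_sequentially using ur by (auto simp: dist_norm) (metis norm_minus_commute real_norm_def)
  have Kgc: "continuous_on X (Kop (g n))" for n by (intro continuous_intros Vc gV)
  have Kum: "Kop u x = m * u x" if x: "x \<in> X" for x
  proof -
    have "(\<lambda>n. \<integral>y. Kop (g (r n)) y * k x y \<partial>\<rho>) \<longlonglongrightarrow> (\<integral>y. u y * k x y \<partial>\<rho>)"
      by (rule uniform_limit_integral[OF Kgc u k_section_cont[OF x] ul])
    then have "(\<lambda>n. Kop (Kop (g (r n))) x) \<longlonglongrightarrow> Kop u x" by (simp add: Kop_def[of _ x] mult.commute)
    moreover have "(\<lambda>n. Kop (g (r n)) x) \<longlonglongrightarrow> u x" using tendsto_uniform_limitI[OF ul x] .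
    ultimately have "(\<lambda>n. Kop (Kop (g (r n))) x - m * Kop (g (r n)) x) \<longlonglongrightarrow> Kop u x - m * u x"
      by (intro tendsto_intros)
    \<comment> \<open>Applying \<open>Kop\<close> to the residual turns it into the residual of the
      images, and upgrades its smallness from L^2 to pointwise.\<close>
    moreover have "Kop (Kop (g n)) x - m * Kop (g n) x = Kop (f n) x" for n
      unfolding f_def using Kop_lincomb[OF cont_integrable[OF Kgc] cont_integrable[OF Vc[OF gV]] x, of 1 n "-m" n] by simp
    moreover have "(\<lambda>n. Kop (f (r n)) x) \<longlonglongrightarrow> 0"
    proof (rule LIMSEQ_subseq_LIMSEQ[OF _ r, unfolded comp_def], rule Lim_null_comparison)
      show "\<forall>\<^sub>F n in sequentially. norm (Kop (f n) x) \<le> \<kappa> * sqrt (m * (1 / real (Suc n)))"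
      proof (intro always_eventually allI)
        fix n
        have "\<bar>Kop (f n) x\<bar> \<le> \<kappa> * (\<integral>y. \<bar>f n y\<bar> \<partial>\<rho>)" using \<kappa>(2) x by (intro Kop_bound cont_integrable fc) auto
        also have "\<dots> \<le> \<kappa> * sqrt (m * (1 / real (Suc n)))"
          using \<kappa>(1) order_trans[OF integral_abs_le_L2[OF fc] real_sqrt_le_mono[OF f2]] by (intro mult_left_mono) auto
        finally show "norm (Kop (f n) x) \<le> \<kappa> * sqrt (m * (1 / real (Suc n)))" by simp
      qed
      have "(\<lambda>n. \<kappa> * sqrt (m * (1 / real (Suc n)))) \<longlonglongrightarrow> \<kappa> * sqrt (m * 0)"
        by (intro tendsto_intros LIMSEQ_Suc[OF lim_1_over_n])
      then show "(\<lambda>n. \<kappa> * sqrt (m * (1 / real (Suc n)))) \<longlonglongrightarrow> 0" by simp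
    qed
    ultimately have "Kop u x - m * u x = 0" 
      using LIMSEQ_unique[of "\<lambda>n. Kop (f (r n)) x" "Kop u x - m * u x" 0] by simp
    then show ?thesis by simp
  qed
  have uV: "(\<integral>x. u x * e i x \<partial>\<rho>) = 0" for i
  proof -
    have "(\<lambda>n. \<integral>x. Kop (g (r n)) x * e i x \<partial>\<rho>) \<longlonglongrightarrow> (\<integral>x. u x * e i x \<partial>\<rho>)"
      by (rule uniform_limit_integral[OF Kgc u e_cont ul])
    moreover have "(\<integral>x. Kop (g (r n)) x * e i x \<partial>\<rho>) = 0" for n using Kop_V[OF gV] by (simp add: V_def)
    ultimately show ?thesis by (simp add: LIMSEQ_const_iff)
  qed
  \<comment> \<open>Completeness forces the limit to vanish. The images along the subsequence are
    then uniformly small, so \<open>form_le\<close> gives \<open>Q\<close> at most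
    \<open>m / 2\<close>, while the choice of \<open>g\<close> makes it exceed
    \<open>m / 2\<close>.\<close>
  have u0: "u x = 0" if "x \<in> X" for x using e_complete[OF m0 u Kum uV that] .
  obtain N where N: "\<And>n x. n \<ge> N \<Longrightarrow> x \<in> X \<Longrightarrow> norm (Kop (g (r n)) x - u x) < m / 2"
    using ur[of "m / 2"] m0 by auto
  obtain M where M: "M \<noteq> 0" "inverse (real M) < m / 2" using real_arch_inverse[of "m/2"] m0 by auto
  define n where "n = max N M"
  have "Q (g (r n)) \<le> m / 2"
    using N[of n] u0 by (intro form_le gW) (auto simp: n_def less_imp_le)
  moreover have "1 / real (Suc (r n)) < m / 2"
  proof -
    have "M \<le> Suc (r n)" using seq_suble[OF r, of n] by (simp add: n_def)
    then have "1 / real (Suc (r n)) \<le> 1 / real M" using M(1) by (intro divide_left_mono) auto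
    then show ?thesis using M(2) by (simp add: inverse_eq_divide)
  qed
  ultimately show False using gm[of "r n"] by linarith
qed

text \<open>Cauchy-Schwarz for the form, with \<open>Kop g\<close> against \<open>g\<close>, bounds
  the fourth power of the norm of \<open>Kop g\<close> by a multiple of the form at
  \<open>g\<close>, which is 0.\<close>

lemma Kop_V_zero:
  assumes g: "g \<in> V" and x: "x \<in> X"
  shows "Kop g x = 0"
proof -
  have c: "continuous_on X g" using g by (simp add: V_def)
  have "(\<integral>x. Kop g x * Kop g x \<partial>\<rho>)\<^sup>2 \<le> 0"
    using Cauchy_Schwarz_Kop[OF Kop_cont'[OF c] c] Kop_form_V[OF g] by simp
  then have "(\<integral>x. Kop g x * Kop g x \<partial>\<rho>) = 0" by simp
  then show ?thesis using integral_square_zero[OF Kop_cont'[OF c] _ x] by simp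
qed

section \<open>The features, scaled to be orthonormal in the RKHS, and Mercer's expansion\<close>

definition \<phi> :: "nat \<Rightarrow> 'x \<Rightarrow> real" where
  "\<phi> i x = sqrt (lam i) * e i x"

lemma \<phi>_cont: "continuous_on X (\<phi> i)"
  unfolding \<phi>_def by (intro continuous_intros e_cont)

lemma \<phi>_summable:
  assumes "x \<in> X" shows "summable (\<lambda>i. (\<phi> i x)\<^sup>2)" "(\<Sum>i. (\<phi> i x)\<^sup>2) \<le> k x x"
proof -
  have "(\<phi> i x)\<^sup>2 = lam i * (e i x)\<^sup>2" for i using lam_pos[of i] by (simp add: \<phi>_def power_mult_distrib less_imp_le)
  then have *: "(\<Sum>i<n. (\<phi> i x)\<^sup>2) \<le> k x x" for n using kernel_Bessel[OF assms] by simp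
  then show "summable (\<lambda>i. (\<phi> i x)\<^sup>2)" by (intro summableI_nonneg_bounded[where x = "k x x"]) auto
  then show "(\<Sum>i. (\<phi> i x)\<^sup>2) \<le> k x x" using * by (intro suminf_le_const)
qed

text \<open>Cauchy-Schwarz on the tail: the factor from \<open>\<phi>\<close> is at most
  \<open>k x x\<close>, hence bounded in \<open>x\<close>, so the tail of \<open>a\<close> alone
  provides a uniform rate.\<close>

lemma \<phi>_series_uniform:
  assumes a: "summable (\<lambda>i. (a i)\<^sup>2)"
  shows "uniform_limit X (\<lambda>n x. \<Sum>i<n. a i * \<phi> i x) (\<lambda>x. \<Sum>i. a i * \<phi> i x) sequentially"
proof -
  obtain \<kappa> where \<kappa>: "0 < \<kappa>" "\<And>x y. x \<in> X \<Longrightarrow> y \<in> X \<Longrightarrow> \<bar>k x y\<bar> \<le> \<kappa>" using k_bounded by metis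
  have tail: "((\<Sum>i. a i * \<phi> i x) - (\<Sum>i<n. a i * \<phi> i x))\<^sup>2 \<le> (\<Sum>i. (a (i + n))\<^sup>2) * \<kappa>" if x: "x \<in> X" for x n
  proof -
    note s = \<phi>_summable(1)[OF x]
    have sa: "summable (\<lambda>i. (a (i + n))\<^sup>2)" and sp: "summable (\<lambda>i. (\<phi> (i + n) x)\<^sup>2)"
      using a s by (simp_all add: summable_iff_shift[of "\<lambda>i. (a i)\<^sup>2"] summable_iff_shift[of "\<lambda>i. (\<phi> i x)\<^sup>2"])
    have "(\<Sum>i. a i * \<phi> i x) - (\<Sum>i<n. a i * \<phi> i x) = (\<Sum>i. a (i + n) * \<phi> (i + n) x)"
      using suminf_split_initial_segment[OF summable_mult_of_squares(2)[OF a s], of n] by simp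
    then have "((\<Sum>i. a i * \<phi> i x) - (\<Sum>i<n. a i * \<phi> i x))\<^sup>2 \<le> (\<Sum>i. (a (i + n))\<^sup>2) * (\<Sum>i. (\<phi> (i + n) x)\<^sup>2)"
      using Cauchy_Schwarz_suminf[OF sa sp] by simp
    also have "\<dots> \<le> (\<Sum>i. (a (i + n))\<^sup>2) * \<kappa>"
    proof (rule mult_left_mono)
      have "(\<Sum>i. (\<phi> (i + n) x)\<^sup>2) = (\<Sum>i. (\<phi> i x)\<^sup>2) - (\<Sum>i<n. (\<phi> i x)\<^sup>2)"
        by (rule suminf_minus_initial_segment[OF s])
      also have "\<dots> \<le> (\<Sum>i. (\<phi> i x)\<^sup>2)" by (simp add: sum_nonneg)
      also have "\<dots> \<le> \<kappa>" using \<phi>_summable(2)[OF x] \<kappa>(2)[OF x x] by simp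
      finally show "(\<Sum>i. (\<phi> (i + n) x)\<^sup>2) \<le> \<kappa>" .
      show "0 \<le> (\<Sum>i. (a (i + n))\<^sup>2)" by (rule suminf_nonneg[OF sa]) simp
    qed
    finally show ?thesis .
  qed
  have tail0: "(\<lambda>n. \<Sum>i. (a (i + n))\<^sup>2) \<longlonglongrightarrow> 0"
    using tendsto_diff[OF tendsto_const[of "\<Sum>i. (a i)\<^sup>2"] summable_LIMSEQ[OF a]]
    by (simp add: suminf_minus_initial_segment[OF a])
  show ?thesis
    unfolding uniform_limit_iff
  proof (intro allI impI)
    fix \<epsilon> :: real assume "\<epsilon> > 0"
    have "(\<lambda>n. (\<Sum>i. (a (i + n))\<^sup>2) * \<kappa>) \<longlonglongrightarrow> 0" using tendsto_mult_left_zero[OF tail0] .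
    then have "\<forall>\<^sub>F n in sequentially. (\<Sum>i. (a (i + n))\<^sup>2) * \<kappa> < \<epsilon>\<^sup>2"
      using \<open>\<epsilon> > 0\<close> by (intro order_tendstoD) auto
    then show "\<forall>\<^sub>F n in sequentially. \<forall>x\<in>X. dist (\<Sum>i<n. a i * \<phi> i x) (\<Sum>i. a i * \<phi> i x) < \<epsilon>"
    proof eventually_elim
      case (elim n)
      show ?case
      proof
        fix x assume "x \<in> X"
        from tail[OF this, of n] elim have "((\<Sum>i. a i * \<phi> i x) - (\<Sum>i<n. a i * \<phi> i x))\<^sup>2 < \<epsilon>\<^sup>2" by linarith
        then have "\<bar>(\<Sum>i. a i * \<phi> i x) - (\<Sum>i<n. a i * \<phi> i x)\<bar>\<^sup>2 < \<epsilon>\<^sup>2" by simp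
        from power2_less_imp_less[OF this] \<open>\<epsilon> > 0\<close>
        show "dist (\<Sum>i<n. a i * \<phi> i x) (\<Sum>i. a i * \<phi> i x) < \<epsilon>" by (simp add: dist_real_def abs_minus_commute)
      qed
    qed
  qed
qed

lemma \<phi>_series_cont:
  assumes "summable (\<lambda>i. (a i)\<^sup>2)"
  shows "continuous_on X (\<lambda>x. \<Sum>i. a i * \<phi> i x)"
  by (rule uniform_limit_theorem[OF _ \<phi>_series_uniform[OF assms]])
     (auto intro!: always_eventually continuous_intros \<phi>_cont)

lemma \<phi>_series_integral:
  assumes a: "summable (\<lambda>i. (a i)\<^sup>2)" and h: "continuous_on X h"
  shows "(\<lambda>i. a i * (\<integral>x. \<phi> i x * h x \<partial>\<rho>)) sums (\<integral>x. (\<Sum>i. a i * \<phi> i x) * h x \<partial>\<rho>)"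
proof -
  have "(\<lambda>n. \<integral>x. (\<Sum>i<n. a i * \<phi> i x) * h x \<partial>\<rho>) \<longlonglongrightarrow> (\<integral>x. (\<Sum>i. a i * \<phi> i x) * h x \<partial>\<rho>)"
    by (intro uniform_limit_integral \<phi>_series_uniform \<phi>_series_cont a h continuous_intros \<phi>_cont)
  moreover have "(\<integral>x. (\<Sum>i<n. a i * \<phi> i x) * h x \<partial>\<rho>) = (\<Sum>i<n. a i * (\<integral>x. \<phi> i x * h x \<partial>\<rho>))" for n
    using integral_sum_e_mult[OF h, of "\<lambda>i. a i * sqrt (lam i)" "{..<n}"] by (simp add: \<phi>_def mult.assoc)
  ultimately show ?thesis by (simp add: sums_def)
qed

lemma \<phi>_series_coeff:
  assumes a: "summable (\<lambda>i. (a i)\<^sup>2)"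
  shows "(\<integral>x. (\<Sum>i. a i * \<phi> i x) * e j x \<partial>\<rho>) = a j * sqrt (lam j)"
proof -
  have "(\<lambda>i. a i * (\<integral>x. \<phi> i x * e j x \<partial>\<rho>)) = (\<lambda>i. if i = j then a j * sqrt (lam j) else 0)"
    by (auto simp: \<phi>_def mult.assoc e_orth)
  then show ?thesis using \<phi>_series_integral[OF a e_cont[of j]] sums_single[of j "\<lambda>i. a j * sqrt (lam j)"] sums_unique2 by fastforce
qed

text \<open>For fixed \<open>x\<close> let \<open>R\<close> be the difference of \<open>k x\<close>
  and the series. It has no component along any \<open>e i\<close>, so it lies in \<open>V\<close>.
  It is orthogonal to \<open>k x\<close>, because \<open>Kop R x = 0\<close>, and to the series
  termwise; hence to itself.\<close>

theorem Mercer: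
  assumes x: "x \<in> X" and y: "y \<in> X"
  shows "(\<lambda>i. \<phi> i x * \<phi> i y) sums k x y"
proof -
  note s = \<phi>_summable(1)[OF x]
  define g where "g y = (\<Sum>i. \<phi> i x * \<phi> i y)" for y
  have g: "continuous_on X g" unfolding g_def by (rule \<phi>_series_cont[OF s])
  define R where "R y = 1 * k x y + (-1) * g y" for y
  have R: "continuous_on X R" unfolding R_def by (intro continuous_intros k_section_cont x g)
  have Re: "(\<integral>y. R y * e i y \<partial>\<rho>) = 0" for i
  proof -
    have "(\<integral>y. R y * e i y \<partial>\<rho>) = Kop (e i) x - (\<integral>y. g y * e i y \<partial>\<rho>)"
      unfolding R_def by (subst integral_lincomb_mult[OF k_section_cont[OF x] g e_cont]) (simp add: Kop_def)
    also have "\<dots> = 0"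
      unfolding g_def \<phi>_series_coeff[OF s] using lam_pos[of i] by (simp add: e_eig[OF x] \<phi>_def)
    finally show ?thesis .
  qed
  then have RV: "R \<in> V" using R by (simp add: V_def)
  have "(\<integral>y. g y * R y \<partial>\<rho>) = 0"
  proof -
    have "(\<integral>y. \<phi> i y * R y \<partial>\<rho>) = 0" for i
      using Re[of i] by (simp add: \<phi>_def mult.assoc) (simp add: mult.commute)
    then show ?thesis using \<phi>_series_integral[OF s R] unfolding g_def by (simp add: sums_iff)
  qed
  moreover have "(\<integral>y. k x y * R y \<partial>\<rho>) = 0" using Kop_V_zero[OF RV x] by (simp add: Kop_def)
  ultimately have "(\<integral>y. R y * R y \<partial>\<rho>) = 0"
    using integral_lincomb_mult[OF k_section_cont[OF x] g R, of 1 "-1"] by (simp add: R_def[symmetric])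
      (simp add: R_def)
  then have "R y = 0" using integral_square_zero[OF R _ y] by simp
  then show ?thesis
    using summable_sums[OF summable_mult_of_squares(2)[OF s \<phi>_summable(1)[OF y]]] by (simp add: R_def g_def)
qed

end

sublocale mercer_kernel \<subseteq> feature_kernel X k \<phi>
proof
  show "(\<lambda>i. \<phi> i x * \<phi> i y) sums k x y" if "x \<in> X" "y \<in> X" for x y using that by (rule Mercer)
  fix a :: "nat \<Rightarrow> real" and i
  assume a: "summable (\<lambda>i. (a i)\<^sup>2)" and z: "\<And>x. x \<in> X \<Longrightarrow> (\<lambda>i. a i * \<phi> i x) sums 0"
  have "(\<integral>x. (\<Sum>i. a i * \<phi> i x) * e i x \<partial>\<rho>) = (\<integral>x. 0 \<partial>\<rho>)"
    by (rule Bochner_Integration.integral_cong) (use z in \<open>auto simp: sums_iff\<close>)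
  then show "a i = 0" using \<phi>_series_coeff[OF a, of i] lam_pos[of i] by simp
qed

context mercer_kernel
begin

section \<open>Passing between expansions in L^2 and expansions at every point\<close>

lemma expansion_L2:
  assumes a: "summable (\<lambda>i. (a i)\<^sup>2)" and g: "\<And>x. x \<in> X \<Longrightarrow> (\<lambda>i. a i * \<phi> i x) sums g x"
  shows "(\<integral>x. g x * e j x \<partial>\<rho>) = a j * sqrt (lam j)"
    and "(\<lambda>n. \<integral>x. (g x - (\<Sum>i<n. a i * sqrt (lam i) * e i x))\<^sup>2 \<partial>\<rho>) \<longlonglongrightarrow> 0"
proof -
  have gs: "g x = (\<Sum>i. a i * \<phi> i x)" if "x \<in> X" for x using g[OF that] by (simp add: sums_iff)
  have "(\<integral>x. g x * e j x \<partial>\<rho>) = (\<integral>x. (\<Sum>i. a i * \<phi> i x) * e j x \<partial>\<rho>)"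
    by (rule Bochner_Integration.integral_cong) (use gs in auto)
  then show "(\<integral>x. g x * e j x \<partial>\<rho>) = a j * sqrt (lam j)" using \<phi>_series_coeff[OF a] by simp
  define T where "T n x = (\<Sum>i. a i * \<phi> i x) - (\<Sum>i<n. a i * \<phi> i x)" for n x
  have Tc: "continuous_on X (T n)" for n
    unfolding T_def by (intro continuous_intros \<phi>_series_cont a \<phi>_cont)
  have eq: "(\<integral>x. (g x - (\<Sum>i<n. a i * sqrt (lam i) * e i x))\<^sup>2 \<partial>\<rho>) = (\<integral>x. (T n x)\<^sup>2 \<partial>\<rho>)" for n
    by (rule Bochner_Integration.integral_cong) (auto simp: T_def gs \<phi>_def mult.assoc)
  have "(\<lambda>n. \<integral>x. (T n x)\<^sup>2 \<partial>\<rho>) \<longlonglongrightarrow> 0"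
  proof (rule LIMSEQ_I)
    fix \<epsilon> :: real assume \<epsilon>: "\<epsilon> > 0"
    then have "sqrt (\<epsilon> / 2) > 0" by simp
    from uniform_limitD[OF \<phi>_series_uniform[OF a] this] obtain N
      where N: "\<And>n x. n \<ge> N \<Longrightarrow> x \<in> X \<Longrightarrow> \<bar>T n x\<bar> < sqrt (\<epsilon> / 2)"
      by (auto simp: eventually_sequentially dist_real_def T_def abs_minus_commute)
    have "norm ((\<integral>x. (T n x)\<^sup>2 \<partial>\<rho>) - 0) < \<epsilon>" if "n \<ge> N" for n
    proof -
      have "(\<integral>x. (T n x)\<^sup>2 \<partial>\<rho>) \<le> \<epsilon> / 2"
      proof (rule integral_le_const)
        show "integrable \<rho> (\<lambda>x. (T n x)\<^sup>2)" by (intro cont_integrable continuous_intros Tc)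
        show "(T n x)\<^sup>2 \<le> \<epsilon> / 2" if "x \<in> X" for x
          using power_mono[OF less_imp_le[OF N[OF \<open>n \<ge> N\<close> that]], of 2] \<epsilon> by simp
      qed
      moreover have "(\<integral>x. (T n x)\<^sup>2 \<partial>\<rho>) \<ge> 0" by (rule Bochner_Integration.integral_nonneg) simp
      ultimately show ?thesis using \<epsilon> by simp
    qed
    then show "\<exists>N. \<forall>n\<ge>N. norm ((\<integral>x. (T n x)\<^sup>2 \<partial>\<rho>) - 0) < \<epsilon>" by blast
  qed
  then show "(\<lambda>n. \<integral>x. (g x - (\<Sum>i<n. a i * sqrt (lam i) * e i x))\<^sup>2 \<partial>\<rho>) \<longlonglongrightarrow> 0" by (simp add: eq)
qed

text \<open>The weighted summability makes the series converge uniformly to a continuous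
  \<open>g'\<close>. Both \<open>g\<close> and \<open>g'\<close> are L^2 limits of the same partial
  sums, and continuous functions equal in L^2 agree everywhere on the support.\<close>

lemma L2_expansion_pointwise:
  assumes g: "continuous_on X g"
    and lim: "(\<lambda>n. \<integral>x. (g x - (\<Sum>i<n. c i * e i x))\<^sup>2 \<partial>\<rho>) \<longlonglongrightarrow> 0"
    and c: "summable (\<lambda>i. (c i)\<^sup>2 / lam i)" and x: "x \<in> X"
  shows "(\<lambda>i. (c i / sqrt (lam i)) * \<phi> i x) sums g x"
proof -
  define a where "a i = c i / sqrt (lam i)" for i
  have a: "summable (\<lambda>i. (a i)\<^sup>2)"
    using c lam_pos by (simp add: a_def power_divide less_imp_le)
  have ac: "a i * sqrt (lam i) = c i" for i using lam_pos[of i] by (simp add: a_def)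
  have as: "(\<lambda>i. a i * \<phi> i x) sums (\<Sum>i. a i * \<phi> i x)" if "x \<in> X" for x
    by (intro summable_sums summable_mult_of_squares(2) a \<phi>_summable that)
  define g' where "g' x = (\<Sum>i. a i * \<phi> i x)" for x
  have g': "continuous_on X g'" unfolding g'_def by (rule \<phi>_series_cont[OF a])
  have lim': "(\<lambda>n. \<integral>x. (g' x - (\<Sum>i<n. c i * e i x))\<^sup>2 \<partial>\<rho>) \<longlonglongrightarrow> 0"
    using expansion_L2(2)[OF a as] by (simp add: ac g'_def)
  define D where "D = (\<integral>x. (g x - g' x)\<^sup>2 \<partial>\<rho>)"
  have "D \<le> 2 * (\<integral>x. (g x - (\<Sum>i<n. c i * e i x))\<^sup>2 \<partial>\<rho>) + 2 * (\<integral>x. (g' x - (\<Sum>i<n. c i * e i x))\<^sup>2 \<partial>\<rho>)" for n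
  proof -
    let ?s = "\<lambda>x. \<Sum>i<n. c i * e i x"
    have i: "integrable \<rho> (\<lambda>x. (g x - ?s x)\<^sup>2)" "integrable \<rho> (\<lambda>x. (g' x - ?s x)\<^sup>2)"
      by (intro cont_integrable continuous_intros g g' e_cont)+
    have "D \<le> (\<integral>x. 2 * (g x - ?s x)\<^sup>2 + 2 * (g' x - ?s x)\<^sup>2 \<partial>\<rho>)"
      unfolding D_def
    proof (rule integral_mono)
      show "integrable \<rho> (\<lambda>x. (g x - g' x)\<^sup>2)" by (intro cont_integrable continuous_intros g g')
      show "integrable \<rho> (\<lambda>x. 2 * (g x - ?s x)\<^sup>2 + 2 * (g' x - ?s x)\<^sup>2)" using i by simp
      fix x
      have "0 \<le> ((g x - ?s x) + (g' x - ?s x))\<^sup>2" by simp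
      then show "(g x - g' x)\<^sup>2 \<le> 2 * (g x - ?s x)\<^sup>2 + 2 * (g' x - ?s x)\<^sup>2"
        by (simp add: power2_eq_square algebra_simps)
    qed
    then show ?thesis using i by simp
  qed
  moreover have "(\<lambda>n. 2 * (\<integral>x. (g x - (\<Sum>i<n. c i * e i x))\<^sup>2 \<partial>\<rho>) + 2 * (\<integral>x. (g' x - (\<Sum>i<n. c i * e i x))\<^sup>2 \<partial>\<rho>)) \<longlonglongrightarrow> 2 * 0 + 2 * 0"
    by (intro tendsto_intros lim lim')
  ultimately have "D \<le> 0" using tendsto_lowerbound[of _ "2 * 0 + 2 * 0" sequentially D] by simp
  moreover have "D \<ge> 0" unfolding D_def by (rule Bochner_Integration.integral_nonneg) simp
  ultimately have "D = 0" by simp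
  then have "(\<integral>x. (g x - g' x) * (g x - g' x) \<partial>\<rho>) = 0" by (simp add: D_def power2_eq_square)
  from integral_square_zero[OF _ this x] g g' have "g x = g' x" by (simp add: continuous_on_diff)
  then show ?thesis using as[OF x] by (simp add: a_def g'_def)
qed

end

section \<open>Signed mixtures of transition probabilities\<close>

text \<open>Only integrals of continuous functions are known to be measurable in \<open>x\<close>.
  Closed sets suffice as an intersection-stable generator, and their indicators are limits of
  continuous functions of the distance to the set.\<close>

lemma transition_measurable:
  fixes S :: "'s::metric_space set" and Pk :: "'x \<Rightarrow> 's measure"
  assumes S: "closed S"
    and prob: "\<And>x. x \<in> space M \<Longrightarrow> prob_space (Pk x)"
    and sets_Pk: "\<And>x. x \<in> space M \<Longrightarrow> sets (Pk x) = sets (restrict_space borel S)"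
    and meas: "\<And>f. bcont_on S f \<Longrightarrow> (\<lambda>x. \<integral>s. f s \<partial>(Pk x)) \<in> borel_measurable M"
  shows "Pk \<in> measurable M (subprob_algebra (restrict_space borel S))"
proof (rule measurable_prob_algebraD, rule measurable_prob_algebra_generated[where \<Omega> = S and G = "(\<inter>) S ` Collect closed"])
  show "sets (restrict_space borel S) = sigma_sets S ((\<inter>) S ` Collect closed)"
    unfolding sets_restrict_space using sigma_sets_Int[of S UNIV "Collect closed"] S
    by (subst borel_eq_closed) auto
  show "Int_stable ((\<inter>) S ` Collect closed)"
  proof (rule Int_stableI)
    fix a b assume "a \<in> (\<inter>) S ` Collect closed" "b \<in> (\<inter>) S ` Collect closed"
    then obtain C D where "closed C" "closed D" "a = S \<inter> C" "b = S \<inter> D" by auto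
    then show "a \<inter> b \<in> (\<inter>) S ` Collect closed" by (intro image_eqI[of _ _ "C \<inter> D"]) auto
  qed
  show "(\<inter>) S ` Collect closed \<subseteq> Pow S" by auto
  fix D assume "D \<in> (\<inter>) S ` Collect closed"
  then have D: "closed D" "D \<subseteq> S" using S by auto
  show "(\<lambda>x. emeasure (Pk x) D) \<in> borel_measurable M"
  proof (cases "D = {}")
    case False
    \<comment> \<open>A nonempty \<open>D\<close> is essential: \<open>infdist\<close> to the empty
      set is 0 by convention, so these functions would be constantly 1.\<close>
    define f where "f n s = max 0 (1 - real n * infdist s D)" for n s
    have f01: "0 \<le> f n s" "f n s \<le> 1" for n s by (auto simp: f_def infdist_nonneg)
    have fb: "bcont_on S (f n)" for n
      unfolding bcont_on_def
    proof
      show "continuous_on S (f n)" unfolding f_def by (intro continuous_intros)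
      show "bounded (f n ` S)" using f01 by (intro boundedI[of _ 1]) auto
    qed
    have flim: "(\<lambda>n. f n s) \<longlonglongrightarrow> indicator D s" for s
    proof (cases "s \<in> D")
      case True
      then show ?thesis by (simp add: f_def)
    next
      case False
      then have "infdist s D > 0" using D(1) \<open>D \<noteq> {}\<close> in_closed_iff_infdist_zero infdist_nonneg
        by (metis less_eq_real_def)
      then obtain N :: nat where N: "1 < real N * infdist s D" using reals_Archimedean3 by blast
      have "f n s = 0" if "n \<ge> N" for n
      proof -
        have "real N * infdist s D \<le> real n * infdist s D" using that by (intro mult_right_mono) (auto simp: infdist_nonneg)
        then show ?thesis using N by (simp add: f_def)
      qed
      then have "\<forall>\<^sub>F n in sequentially. f n s = 0" by (auto simp: eventually_sequentially)
      then show ?thesis using False by (simp add: tendsto_eventually)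
    qed
    have "(\<lambda>x. measure (Pk x) D) \<in> borel_measurable M"
    proof (rule borel_measurable_LIMSEQ_real)
      show "(\<lambda>x. \<integral>s. f n s \<partial>(Pk x)) \<in> borel_measurable M" for n by (rule meas[OF fb])
      fix x assume x: "x \<in> space M"
      interpret prob_space "Pk x" by (rule prob[OF x])
      have DP: "D \<in> sets (Pk x)" using D by (auto simp: sets_Pk[OF x] sets_restrict_space)
      have "(\<lambda>n. \<integral>s. f n s \<partial>(Pk x)) \<longlonglongrightarrow> (\<integral>s. indicator D s \<partial>(Pk x))"
      proof (rule integral_dominated_convergence[where w = "\<lambda>_. 1"])
        show "f n \<in> borel_measurable (Pk x)" for n
          using fb[of n] unfolding bcont_on_def
          by (subst measurable_cong_sets[OF sets_Pk[OF x] refl]) (auto intro: borel_measurable_continuous_on_restrict)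
        show "AE s in Pk x. norm (f n s) \<le> 1" for n using f01 by (intro AE_I2) auto
      qed (use DP flim in auto)
      then show "(\<lambda>n. \<integral>s. f n s \<partial>(Pk x)) \<longlonglongrightarrow> measure (Pk x) D"
        using DP by simp
    qed
    then have "(\<lambda>x. ennreal (measure (Pk x) D)) \<in> borel_measurable M" by measurable
    then show ?thesis
      by (rule measurable_cong[THEN iffD1, rotated])
         (use prob in \<open>auto simp: finite_measure.emeasure_eq_measure prob_space.finite_measure\<close>)
  qed simp
qed (use prob sets_Pk in auto)

text \<open>The measure is the average of the \<open>Pk x\<close> weighted by the positive part of
  \<open>w\<close>, realised as the monadic bind of a density with the kernel; finiteness of the
  density is integrability of \<open>w\<close>.\<close>

lemma weighted_mixture:
  fixes Pk :: "'x \<Rightarrow> 's measure"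
  assumes M: "prob_space M" and Pk: "Pk \<in> measurable M (subprob_algebra N)" and w: "integrable M (w :: 'x \<Rightarrow> real)"
  obtains \<nu> where "finite_measure \<nu>" "sets \<nu> = sets N"
    "\<And>f B. f \<in> borel_measurable N \<Longrightarrow> (\<And>s. s \<in> space N \<Longrightarrow> \<bar>f s\<bar> \<le> (B :: real)) \<Longrightarrow>
      (\<integral>s. f s \<partial>\<nu>) = (\<integral>x. max 0 (w x) * (\<integral>s. f s \<partial>(Pk x)) \<partial>M)"
proof -
  define W where "W = density M (\<lambda>x. ennreal (max 0 (w x)))"
  have wm [measurable]: "w \<in> borel_measurable M" using w by simp
  have PW: "Pk \<in> measurable W (subprob_algebra N)" using Pk by (simp add: W_def)
  have neM: "space M \<noteq> {}" by (rule prob_space.not_empty[OF M])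
  then have ne: "space W \<noteq> {}" by (simp add: W_def)
  have wi: "integrable M (\<lambda>x. max 0 (w x))" using w by simp
  have finW: "finite_measure W"
  proof
    have "emeasure W (space W) = (\<integral>\<^sup>+x. ennreal (max 0 (w x)) \<partial>M)"
      unfolding W_def by (simp add: emeasure_density cong: nn_integral_cong)
    also have "\<dots> = ennreal (\<integral>x. max 0 (w x) \<partial>M)" using wi by (intro nn_integral_eq_integral) auto
    finally show "emeasure W (space W) \<noteq> \<infinity>" by simp
  qed
  define J where "J = distr W (subprob_algebra N) Pk"
  have J: "sets J = sets (subprob_algebra N)" "finite_measure J" "AE M' in J. emeasure M' (space M') \<le> ennreal 1"
  proof -
    show "sets J = sets (subprob_algebra N)" by (simp add: J_def)
    show "finite_measure J" unfolding J_def by (rule finite_measure.finite_measure_distr[OF finW PW])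
    show "AE M' in J. emeasure M' (space M') \<le> ennreal 1"
      by (intro AE_I2) (auto simp: J_def space_subprob_algebra subprob_space.emeasure_space_le_1)
  qed
  have eq: "W \<bind> Pk = join J" unfolding J_def by (rule bind_nonempty''[OF PW ne])
  show ?thesis
  proof
    show "sets (W \<bind> Pk) = sets N" by (rule sets_bind_measurable[OF PW ne])
    show "finite_measure (W \<bind> Pk)"
    proof
      have "emeasure (W \<bind> Pk) (space N) = (\<integral>\<^sup>+x. emeasure (Pk x) (space N) \<partial>W)"
        by (rule emeasure_bind[OF ne PW]) simp
      also have "\<dots> \<le> (\<integral>\<^sup>+x. 1 \<partial>W)"
      proof (rule nn_integral_mono)
        fix x assume "x \<in> space W"
        then have "Pk x \<in> space (subprob_algebra N)" using PW by (rule measurable_space[rotated])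
        then have "subprob_space (Pk x)" "space (Pk x) = space N"
          by (auto simp: space_subprob_algebra dest: sets_eq_imp_space_eq)
        then show "emeasure (Pk x) (space N) \<le> 1" using subprob_space.emeasure_space_le_1[of "Pk x"] by simp
      qed
      also have "\<dots> < \<infinity>" using finite_measure.emeasure_finite[OF finW] by (simp add: less_top)
      finally show "emeasure (W \<bind> Pk) (space (W \<bind> Pk)) \<noteq> \<infinity>"
        by (simp add: space_bind_measurable[OF PW ne])
    qed
    fix f :: "'s \<Rightarrow> real" and B assume f: "f \<in> borel_measurable N" and B: "\<And>s. s \<in> space N \<Longrightarrow> \<bar>f s\<bar> \<le> B"
    have "(\<integral>s. f s \<partial>(W \<bind> Pk)) = (\<integral>M'. integral\<^sup>L M' f \<partial>J)"
      unfolding eq by (rule integral_join[OF f B J(1) J(2,3)])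
    also have "\<dots> = (\<integral>x. integral\<^sup>L (Pk x) f \<partial>W)"
      unfolding J_def by (rule integral_distr[OF PW integral_measurable_subprob_algebra[OF f]])
    also have "\<dots> = (\<integral>x. max 0 (w x) *\<^sub>R integral\<^sup>L (Pk x) f \<partial>M)"
      unfolding W_def
      by (rule integral_density) (auto intro!: measurable_compose[OF Pk integral_measurable_subprob_algebra[OF f]])
    finally show "(\<integral>s. f s \<partial>(W \<bind> Pk)) = (\<integral>x. max 0 (w x) * (\<integral>s. f s \<partial>(Pk x)) \<partial>M)" by simp
  qed
qed

text \<open>The two components are the mixtures for the positive and the negative part of
  \<open>w\<close>. The pair depends on \<open>w\<close> but not on \<open>f\<close>, which is what
  a representing measure requires.\<close>

lemma signed_mixture:
  fixes S :: "'s::metric_space set" and Pk :: "'x \<Rightarrow> 's measure"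
  assumes M: "prob_space M" and S: "closed S"
    and prob: "\<And>x. x \<in> space M \<Longrightarrow> prob_space (Pk x)"
    and sets_Pk: "\<And>x. x \<in> space M \<Longrightarrow> sets (Pk x) = sets (restrict_space borel S)"
    and meas: "\<And>f. bcont_on S f \<Longrightarrow> (\<lambda>x. \<integral>s. f s \<partial>(Pk x)) \<in> borel_measurable M"
    and w: "integrable M w"
  obtains \<mu> where "fin_signed_measure_on S \<mu>"
    "\<And>f. bcont_on S f \<Longrightarrow> signed_integral \<mu> f = (\<integral>x. (\<integral>s. f s \<partial>(Pk x)) * w x \<partial>M)"
proof -
  let ?N = "restrict_space borel S"
  have Pk: "Pk \<in> measurable M (subprob_algebra ?N)" by (rule transition_measurable[OF S prob sets_Pk meas])
  obtain p where p: "finite_measure p" "sets p = sets ?N"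
    "\<And>f B. f \<in> borel_measurable ?N \<Longrightarrow> (\<And>s. s \<in> space ?N \<Longrightarrow> \<bar>f s\<bar> \<le> (B :: real)) \<Longrightarrow>
      (\<integral>s. f s \<partial>p) = (\<integral>x. max 0 (w x) * (\<integral>s. f s \<partial>(Pk x)) \<partial>M)"
    using weighted_mixture[OF M Pk w] by blast
  have w': "integrable M (\<lambda>x. - w x)" using w by simp
  obtain q where q: "finite_measure q" "sets q = sets ?N"
    "\<And>f B. f \<in> borel_measurable ?N \<Longrightarrow> (\<And>s. s \<in> space ?N \<Longrightarrow> \<bar>f s\<bar> \<le> (B :: real)) \<Longrightarrow>
      (\<integral>s. f s \<partial>q) = (\<integral>x. max 0 (- w x) * (\<integral>s. f s \<partial>(Pk x)) \<partial>M)"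
    using weighted_mixture[OF M Pk w'] by blast
  show ?thesis
  proof
    show "fin_signed_measure_on S (p, q)" using p q by (simp add: fin_signed_measure_on_def)
    fix f assume f: "bcont_on S f"
    then have fm: "f \<in> borel_measurable ?N" by (auto simp: bcont_on_def intro: borel_measurable_continuous_on_restrict)
    obtain B where B: "\<And>s. s \<in> S \<Longrightarrow> \<bar>f s\<bar> \<le> B" using f unfolding bcont_on_def bounded_iff by auto
    have spN: "space ?N = S" by (simp add: space_restrict_space)
    have Eb: "\<bar>\<integral>s. f s \<partial>(Pk x)\<bar> \<le> B" if x: "x \<in> space M" for x
    proof -
      interpret prob_space "Pk x" by (rule prob[OF x])
      have sp: "space (Pk x) = S" using sets_eq_imp_space_eq[OF sets_Pk[OF x]] spN by simp
      have "f \<in> borel_measurable (Pk x)" using fm measurable_cong_sets[OF sets_Pk[OF x] refl] by blast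
      then have "integrable (Pk x) f" using B sp by (intro integrable_const_bound[of _ B]) auto
      then have "(\<integral>s. \<bar>f s\<bar> \<partial>(Pk x)) \<le> (\<integral>s. B \<partial>(Pk x))"
        using B sp by (intro integral_mono) auto
      then have "(\<integral>s. \<bar>f s\<bar> \<partial>(Pk x)) \<le> B" using prob_space by simp
      then show ?thesis using integral_abs_bound[of "Pk x" f] by linarith
    qed
    have int: "integrable M (\<lambda>x. max 0 (v x) * (\<integral>s. f s \<partial>(Pk x)))" if v: "integrable M v" for v :: "'x \<Rightarrow> real"
    proof (rule Bochner_Integration.integrable_bound)
      show "integrable M (\<lambda>x. B * v x)" using v by simp
      have [measurable]: "v \<in> borel_measurable M" "(\<lambda>x. \<integral>s. f s \<partial>(Pk x)) \<in> borel_measurable M"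
        using v meas[OF f] by auto
      show "(\<lambda>x. max 0 (v x) * (\<integral>s. f s \<partial>(Pk x))) \<in> borel_measurable M" by measurable
      show "AE x in M. norm (max 0 (v x) * (\<integral>s. f s \<partial>(Pk x))) \<le> norm (B * v x)"
      proof (rule AE_I2)
        fix x assume "x \<in> space M"
        from Eb[OF this] have "\<bar>max 0 (v x)\<bar> * \<bar>\<integral>s. f s \<partial>(Pk x)\<bar> \<le> \<bar>v x\<bar> * \<bar>B\<bar>"
          by (intro mult_mono) auto
        then show "norm (max 0 (v x) * (\<integral>s. f s \<partial>(Pk x))) \<le> norm (B * v x)" by (simp add: abs_mult mult.commute)
      qed
    qed
    have "signed_integral (p, q) f = (\<integral>x. max 0 (w x) * (\<integral>s. f s \<partial>(Pk x)) \<partial>M) - (\<integral>x. max 0 (- w x) * (\<integral>s. f s \<partial>(Pk x)) \<partial>M)"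
      unfolding signed_integral_def using p(3)[OF fm, of B] q(3)[OF fm, of B] B by (simp add: spN)
    also have "\<dots> = (\<integral>x. max 0 (w x) * (\<integral>s. f s \<partial>(Pk x)) - max 0 (- w x) * (\<integral>s. f s \<partial>(Pk x)) \<partial>M)"
      using int[OF w] int[OF w'] by simp
    also have "\<dots> = (\<integral>x. (\<integral>s. f s \<partial>(Pk x)) * w x \<partial>M)"
      by (rule Bochner_Integration.integral_cong) (auto simp: max_def)
    finally show "signed_integral (p, q) f = (\<integral>x. (\<integral>s. f s \<partial>(Pk x)) * w x \<partial>M)" .
  qed
qed

lemma sup_norm_on_upper:
  assumes "bcont_on S f" "s \<in> S" shows "\<bar>f s\<bar> \<le> sup_norm_on S f"
proof -
  have "bounded (f ` S)" using assms(1) by (simp add: bcont_on_def)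
  then obtain B where "\<And>s. s \<in> S \<Longrightarrow> \<bar>f s\<bar> \<le> B" unfolding bounded_iff by auto
  then have "bdd_above ((\<lambda>s. \<bar>f s\<bar>) ` S)" by (intro bdd_aboveI[of _ B]) auto
  then show ?thesis unfolding sup_norm_on_def using cSUP_upper[OF assms(2), of "\<lambda>s. \<bar>f s\<bar>"] by simp
qed

text \<open>Normalisation to the unit ball without a case distinction: for norm 0 the quotient is 0
  by the convention on division.\<close>

lemma sup_norm_on_scale:
  assumes f: "bcont_on S f" and S: "S \<noteq> {}"
  shows "bcont_on S (\<lambda>s. f s / sup_norm_on S f)" "sup_norm_on S (\<lambda>s. f s / sup_norm_on S f) \<le> 1"
    "0 \<le> sup_norm_on S f"
proof -
  obtain s where "s \<in> S" using S by blast
  then show nn: "0 \<le> sup_norm_on S f" using sup_norm_on_upper[OF f] abs_ge_zero order_trans by metis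
  have le1: "\<bar>f s / sup_norm_on S f\<bar> \<le> 1" if "s \<in> S" for s
    using sup_norm_on_upper[OF f that] nn by (cases "sup_norm_on S f = 0") (auto simp: field_simps)
  then show "sup_norm_on S (\<lambda>s. f s / sup_norm_on S f) \<le> 1"
    unfolding sup_norm_on_def[of S "\<lambda>s. f s / sup_norm_on S f"] using S by (intro cSUP_least)
  show "bcont_on S (\<lambda>s. f s / sup_norm_on S f)"
    unfolding bcont_on_def
  proof
    show "continuous_on S (\<lambda>s. f s / sup_norm_on S f)"
      using f unfolding bcont_on_def divide_inverse by (intro continuous_intros) auto
    show "bounded ((\<lambda>s. f s / sup_norm_on S f) ` S)" using le1 by (intro boundedI[of _ 1]) auto
  qed
qed

section \<open>The equivalence\<close>

theorem theorem3:
  fixes S :: "'s::euclidean_space set" and A :: "'a::euclidean_space set"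
    and H :: nat
    and P :: "nat \<Rightarrow> 's \<Rightarrow> 'a \<Rightarrow> 's measure"
    and r :: "nat \<Rightarrow> 's \<Rightarrow> 'a \<Rightarrow> real"
    and k :: "'s \<times> 'a \<Rightarrow> 's \<times> 'a \<Rightarrow> real"
    and \<rho> :: "('s \<times> 'a) measure"
    and lam :: "nat \<Rightarrow> real"
    and \<psi> :: "nat \<Rightarrow> 's \<times> 'a \<Rightarrow> real"
  assumes cpt: "compact (S \<times> A)"
    and P_prob: "\<forall>h\<in>{1..H}. \<forall>s\<in>S. \<forall>a\<in>A. prob_space (P h s a) \<and> sets (P h s a) = sets (restrict_space borel S)"
    and r_cont: "\<forall>h\<in>{1..H}. continuous_on (S \<times> A) (\<lambda>x. r h (fst x) (snd x))"
    and r_range: "\<forall>h\<in>{1..H}. \<forall>s\<in>S. \<forall>a\<in>A. 0 \<le> r h s a \<and> r h s a \<le> 1"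
    and P_cont: "\<forall>h\<in>{1..H}. \<forall>f. bcont_on S f \<longrightarrow>
                   continuous_on (S \<times> A) (\<lambda>x. \<integral>s'. f s' \<partial>(P h (fst x) (snd x)))"
    and k_cont: "continuous_on ((S \<times> A) \<times> (S \<times> A)) (\<lambda>z. k (fst z) (snd z))"
    and k_pd: "pd_kernel_on (S \<times> A) k"
    and \<rho>_prob: "prob_space \<rho>"
    and \<rho>_sets: "sets \<rho> = sets (restrict_space borel (S \<times> A))"
    and \<rho>_supp: "full_support_on (S \<times> A) \<rho>"
    and lam_pos: "\<forall>i. lam i > 0"
    and lam_mono: "decseq lam"
    and \<psi>_L2: "\<forall>i. \<psi> i \<in> borel_measurable \<rho> \<and> integrable \<rho> (\<lambda>x. (\<psi> i x)\<^sup>2)"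
    and \<psi>_orth: "\<forall>i j. (\<integral>x. \<psi> i x * \<psi> j x \<partial>\<rho>) = (if i = j then 1 else 0)"
    and \<psi>_eig: "\<forall>i. AE x in \<rho>. (\<integral>y. k x y * \<psi> i y \<partial>\<rho>) = lam i * \<psi> i x"
    and \<psi>_complete: "\<forall>m g. m > 0 \<longrightarrow> g \<in> borel_measurable \<rho> \<longrightarrow> integrable \<rho> (\<lambda>x. (g x)\<^sup>2) \<longrightarrow>
                   (AE x in \<rho>. (\<integral>y. k x y * g y \<partial>\<rho>) = m * g x) \<longrightarrow>
                   (\<forall>i. (\<integral>x. g x * \<psi> i x \<partial>\<rho>) = 0) \<longrightarrow> (AE x in \<rho>. g x = 0)"
  shows "(\<forall>h\<in>{1..H}.
            in_rkhs k (S \<times> A) (\<lambda>x. r h (fst x) (snd x)) \<and>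
            (\<exists>\<mu> :: nat \<Rightarrow> 's measure \<times> 's measure. \<exists>C>0.
               (\<forall>i. fin_signed_measure_on S (\<mu> i)) \<and>
               (\<forall>f. bcont_on S f \<longrightarrow>
                  ((\<lambda>n. \<integral>x. ((\<integral>s'. f s' \<partial>(P h (fst x) (snd x)))
                             - (\<Sum>i<n. signed_integral (\<mu> i) f * \<psi> i x))\<^sup>2 \<partial>\<rho>) \<longlonglongrightarrow> 0) \<and>
                  summable (\<lambda>i. (signed_integral (\<mu> i) f)\<^sup>2 / lam i) \<and>
                  (\<Sum>i. (signed_integral (\<mu> i) f)\<^sup>2 / lam i) \<le> C * (sup_norm_on S f)\<^sup>2)))
         \<longleftrightarrow>
         (\<exists>C'>0. \<forall>h\<in>{1..H}. \<forall>f. bcont_on S f \<longrightarrow>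
            in_rkhs k (S \<times> A) (\<lambda>x. r h (fst x) (snd x) + (\<integral>s'. f s' \<partial>(P h (fst x) (snd x)))) \<and>
            rkhs_norm k (S \<times> A) (\<lambda>x. r h (fst x) (snd x) + (\<integral>s'. f s' \<partial>(P h (fst x) (snd x))))
              \<le> C' * (sup_norm_on S f + 1))"
  (is "(\<forall>h\<in>{1..H}. ?rkhs_r h \<and> (\<exists>\<mu>. \<exists>C>0. ?repr h \<mu> C)) \<longleftrightarrow> (\<exists>C'>0. \<forall>h\<in>{1..H}. \<forall>f. bcont_on S f \<longrightarrow> ?bound C' h f)")
proof -
  interpret ck: compact_kernel "S \<times> A" k \<rho>
    by (rule compact_kernel.intro[OF cpt k_cont k_pd \<rho>_prob \<rho>_sets \<rho>_supp])
  \<comment> \<open>The eigenvalue equation solved for \<open>\<psi> i\<close>: the right-hand side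
    is defined at every point and continuous, since \<open>Kop\<close> maps integrable functions to
    continuous ones.\<close>
  define e where "e i x = ck.Kop (\<psi> i) x / lam i" for i x
  have \<psi>_meas [measurable]: "\<psi> i \<in> borel_measurable \<rho>" for i using \<psi>_L2 by blast
  have \<psi>_int: "integrable \<rho> (\<psi> i)" for i
    by (rule ck.square_integrable_imp_integrable[OF \<psi>_meas]) (use \<psi>_L2 in blast)
  have e_cont: "continuous_on (S \<times> A) (e i)" for i
    unfolding e_def divide_inverse by (intro continuous_intros ck.Kop_cont \<psi>_int)
  have [measurable]: "e i \<in> borel_measurable \<rho>" for i by (rule ck.cont_measurable[OF e_cont])
  have e_\<psi>: "AE x in \<rho>. \<forall>i. e i x = \<psi> i x"
    unfolding AE_all_countable
  proof
    fix i
    have "lam i \<noteq> 0" using lam_pos[rule_format, of i] by simp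
    then show "AE x in \<rho>. e i x = \<psi> i x"
      using \<psi>_eig[rule_format, of i] by (auto simp: e_def ck.Kop_def elim!: eventually_mono)
  qed
  have int_e: "(\<integral>x. g x * e i x \<partial>\<rho>) = (\<integral>x. g x * \<psi> i x \<partial>\<rho>)" if [measurable]: "g \<in> borel_measurable \<rho>" for g i
    by (rule integral_cong_AE) (use e_\<psi> in \<open>auto elim!: eventually_mono\<close>)
  interpret mercer_kernel "S \<times> A" k \<rho> lam e
  proof
    show "lam i > 0" for i using lam_pos by simp
    show "continuous_on (S \<times> A) (e i)" for i by (rule e_cont)
    show "(\<integral>x. e i x * e j x \<partial>\<rho>) = (if i = j then 1 else 0)" for i j
    proof -
      have "(\<integral>x. e i x * e j x \<partial>\<rho>) = (\<integral>x. \<psi> i x * \<psi> j x \<partial>\<rho>)"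
        by (rule integral_cong_AE) (use e_\<psi> in \<open>auto elim!: eventually_mono\<close>)
      then show ?thesis using \<psi>_orth by simp
    qed
    show "ck.Kop (e i) x = lam i * e i x" if x: "x \<in> S \<times> A" for i x
    proof -
      have [measurable]: "k x \<in> borel_measurable \<rho>" by (rule ck.cont_measurable[OF ck.k_section_cont[OF x]])
      have "ck.Kop (e i) x = ck.Kop (\<psi> i) x" unfolding ck.Kop_def by (rule int_e) measurable
      then show ?thesis using lam_pos[rule_format, of i] by (simp add: e_def)
    qed
    fix m g x
    assume m: "0 < m" and g: "continuous_on (S \<times> A) g" and eig: "\<And>x. x \<in> S \<times> A \<Longrightarrow> ck.Kop g x = m * g x"
      and orth: "\<And>i. (\<integral>x. g x * e i x \<partial>\<rho>) = 0" and x: "x \<in> S \<times> A"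
    note gm = ck.cont_measurable[OF g]
    have "integrable \<rho> (\<lambda>x. (g x)\<^sup>2)" by (intro ck.cont_integrable continuous_intros g)
    moreover have "AE x in \<rho>. (\<integral>y. k x y * g y \<partial>\<rho>) = m * g x"
      using eig by (intro AE_I2) (simp add: ck.Kop_def)
    moreover have "\<forall>i. (\<integral>x. g x * \<psi> i x \<partial>\<rho>) = 0" using orth int_e[OF gm] by simp
    ultimately have "AE x in \<rho>. g x = 0" using \<psi>_complete m gm by blast
    then show "g x = 0" by (rule ck.cont_AE_zero[OF g _ x])
  qed
  have L2_e: "(\<integral>x. (g x - (\<Sum>i<n. c i * \<psi> i x))\<^sup>2 \<partial>\<rho>) = (\<integral>x. (g x - (\<Sum>i<n. c i * e i x))\<^sup>2 \<partial>\<rho>)"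
    if g: "continuous_on (S \<times> A) g" for g c n
  proof (rule integral_cong_AE)
    have [measurable]: "g \<in> borel_measurable \<rho>" by (rule ck.cont_measurable[OF g])
    show "(\<lambda>x. (g x - (\<Sum>i<n. c i * \<psi> i x))\<^sup>2) \<in> borel_measurable \<rho>"
      "(\<lambda>x. (g x - (\<Sum>i<n. c i * e i x))\<^sup>2) \<in> borel_measurable \<rho>" by measurable
    show "AE x in \<rho>. (g x - (\<Sum>i<n. c i * \<psi> i x))\<^sup>2 = (g x - (\<Sum>i<n. c i * e i x))\<^sup>2"
      using e_\<psi> by (auto elim!: eventually_mono)
  qed
  have ne: "S \<noteq> {}" "A \<noteq> {}" using ck.X_nonempty by auto
  have "compact (fst ` (S \<times> A))"
    by (rule compact_continuous_image[OF continuous_on_fst[OF continuous_on_id] cpt])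
  then have S_closed: "closed S" using ne by (simp add: fst_image_times compact_imp_closed)
  define E where "E h f x = (\<integral>s'. f s' \<partial>(P h (fst x) (snd x)))" for h and f :: "'s \<Rightarrow> real" and x
  define R where "R h x = r h (fst x) (snd x)" for h x
  have E_cont: "continuous_on (S \<times> A) (E h f)" if "h \<in> {1..H}" "bcont_on S f" for h f
    using P_cont that unfolding E_def by blast
  have sup0: "0 \<le> sup_norm_on S f" if "bcont_on S f" for f
    by (rule sup_norm_on_scale(3)[OF that ne(1)])
  \<comment> \<open>Half of the parallelogram law, with \<open>t = 1\<close> for adding the reward
    and \<open>t = -1\<close> for subtracting it.\<close>
  have two_squares: "(\<Sum>i. (a i + t * b i)\<^sup>2) \<le> 2 * (\<Sum>i. (a i)\<^sup>2) + 2 * (\<Sum>i. (b i)\<^sup>2)"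
    if ab: "summable (\<lambda>i. (a i)\<^sup>2)" "summable (\<lambda>i. (b i)\<^sup>2)" and t: "t * t = 1" for a b :: "nat \<Rightarrow> real" and t
  proof -
    have "0 \<le> (\<Sum>i. (1 * a i + (- t) * b i)\<^sup>2)" by (rule suminf_nonneg[OF summable_square_lincomb(1)[OF ab]]) simp
    then show ?thesis using summable_square_lincomb(2)[OF ab, of 1 "- t"] summable_square_lincomb(2)[OF ab, of 1 t] t
      by (simp add: power2_eq_square)
  qed
  define rk where "rk h = ?rkhs_r h" for h
  define rp where "rp h \<mu> C = ?repr h \<mu> C" for h \<mu> C
  define bd where "bd D h f = ?bound D h f" for D h f
  have "(\<forall>h\<in>{1..H}. rk h \<and> (\<exists>\<mu>. \<exists>C>0. rp h \<mu> C)) \<longleftrightarrow>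
    (\<exists>C'>0. \<forall>h\<in>{1..H}. \<forall>f. bcont_on S f \<longrightarrow> bd C' h f)"
  proof
    assume L: "\<forall>h\<in>{1..H}. rk h \<and> (\<exists>\<mu>. \<exists>C>0. rp h \<mu> C)"
    have "\<exists>D>0. \<forall>f. bcont_on S f \<longrightarrow> bd D h f" if h: "h \<in> {1..H}" for h
    proof -
      obtain \<mu> C where C: "C > 0" and rep: "rp h \<mu> C" using L h by blast
      have "rk h" using L h by blast
      then have R_in: "in_rkhs k (S \<times> A) (R h)" by (simp add: rk_def R_def[abs_def])
      obtain a where a: "summable (\<lambda>i. (a i)\<^sup>2)" "\<And>x. x \<in> S \<times> A \<Longrightarrow> (\<lambda>i. a i * \<phi> i x) sums R h x"
        using in_rkhs_coeffs[OF R_in] by blast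
      define N where "N = (\<Sum>i. (a i)\<^sup>2)"
      have N: "N \<ge> 0" unfolding N_def by (rule suminf_nonneg[OF a(1)]) simp
      \<comment> \<open>The squared norm of reward plus expectation is at most 2 N + 2 C F^2 with F
        the sup norm of \<open>f\<close>, and hence at most (2 N + 2 C) (F + 1)^2.\<close>
      define D where "D = sqrt (2 * N + 2 * C)"
      have "bd D h f" if f: "bcont_on S f" for f
      proof -
        define c where "c i = signed_integral (\<mu> i) f" for i
        define F where "F = sup_norm_on S f"
        have F: "F \<ge> 0" using sup0[OF f] by (simp add: F_def)
        have cs: "summable (\<lambda>i. (c i)\<^sup>2 / lam i)" "(\<Sum>i. (c i)\<^sup>2 / lam i) \<le> C * F\<^sup>2"
          and lim: "(\<lambda>n. \<integral>x. (E h f x - (\<Sum>i<n. c i * \<psi> i x))\<^sup>2 \<partial>\<rho>) \<longlonglongrightarrow> 0"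
          using rep[unfolded rp_def, THEN conjunct2, rule_format, OF f] by (simp_all add: c_def E_def F_def)
        define b where "b i = c i / sqrt (lam i)" for i
        have b2: "(b i)\<^sup>2 = (c i)\<^sup>2 / lam i" for i
          using lam_pos[rule_format, of i] by (simp add: b_def power_divide)
        have bs: "summable (\<lambda>i. (b i)\<^sup>2)" "(\<Sum>i. (b i)\<^sup>2) \<le> C * F\<^sup>2" using cs by (simp_all add: b2)
        \<comment> \<open>Condition (1) supplies convergence only in L^2; continuity of the
          expectation turns it into an expansion at every point.\<close>
        have bE: "(\<lambda>i. b i * \<phi> i x) sums E h f x" if "x \<in> S \<times> A" for x
          unfolding b_def using E_cont[OF h f] lim cs(1) that
          by (intro L2_expansion_pointwise) (auto simp: L2_e)
        define d where "d i = a i + 1 * b i" for i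
        have ds: "summable (\<lambda>i. (d i)\<^sup>2)"
          using summable_square_lincomb(1)[OF a(1) bs(1), of 1 1] by (simp add: d_def)
        have dT: "(\<lambda>i. d i * \<phi> i x) sums (R h x + E h f x)" if "x \<in> S \<times> A" for x
          using sums_add[OF a(2)[OF that] bE[OF that]] by (simp add: d_def distrib_right)
        have "(\<Sum>i. (d i)\<^sup>2) \<le> 2 * N + 2 * (C * F\<^sup>2)"
          using two_squares[OF a(1) bs(1), of 1] bs(2) unfolding d_def N_def by simp
        also have "\<dots> \<le> (2 * N + 2 * C) * (F + 1)\<^sup>2"
        proof -
          have "1 \<le> (F + 1)\<^sup>2" "F\<^sup>2 \<le> (F + 1)\<^sup>2" using F by (auto simp: power2_eq_square algebra_simps)
          then have "N * 1 \<le> N * (F + 1)\<^sup>2" "C * F\<^sup>2 \<le> C * (F + 1)\<^sup>2"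
            using N C by (auto intro!: mult_left_mono simp del: mult_1_right)
          then show ?thesis by (simp add: algebra_simps)
        qed
        finally have "sqrt (\<Sum>i. (d i)\<^sup>2) \<le> sqrt ((2 * N + 2 * C) * (F + 1)\<^sup>2)" by (rule real_sqrt_le_mono)
        also have "\<dots> = D * (F + 1)" using F by (simp add: D_def real_sqrt_mult)
        finally have "rkhs_norm k (S \<times> A) (\<lambda>x. R h x + E h f x) \<le> D * (F + 1)"
          using rkhs_norm_of_coeffs[OF ds dT] by simp
        moreover have "in_rkhs k (S \<times> A) (\<lambda>x. R h x + E h f x)" by (rule in_rkhs_of_coeffs[OF ds dT])
        ultimately show ?thesis by (simp add: bd_def R_def E_def F_def)
      qed
      moreover have "D > 0" using N C by (simp add: D_def)
      ultimately show ?thesis by blast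
    qed
    then obtain D where D: "\<And>h. h \<in> {1..H} \<Longrightarrow> D h > 0"
      "\<And>h f. h \<in> {1..H} \<Longrightarrow> bcont_on S f \<Longrightarrow> bd (D h) h f" by metis
    \<comment> \<open>A single constant for the whole horizon; the added 1 keeps it positive when
      \<open>H = 0\<close>.\<close>
    define C' where "C' = (\<Sum>h\<in>{1..H}. D h) + 1"
    have DC: "D h \<le> C'" if "h \<in> {1..H}" for h
      using member_le_sum[OF that, of D] D(1) by (auto simp: C'_def less_imp_le)
    have "C' > 0" unfolding C'_def using D(1) by (intro add_nonneg_pos sum_nonneg) (auto simp: less_imp_le)
    moreover have "bd C' h f" if h: "h \<in> {1..H}" and f: "bcont_on S f" for h f
    proof -
      have "D h * (sup_norm_on S f + 1) \<le> C' * (sup_norm_on S f + 1)"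
        using DC[OF h] sup0[OF f] by (intro mult_right_mono) auto
      then show ?thesis using D(2)[OF h f] unfolding bd_def by (blast intro: order_trans)
    qed
    ultimately show "\<exists>C'>0. \<forall>h\<in>{1..H}. \<forall>f. bcont_on S f \<longrightarrow> bd C' h f" by blast
  next
    assume "\<exists>C'>0. \<forall>h\<in>{1..H}. \<forall>f. bcont_on S f \<longrightarrow> bd C' h f"
    then obtain C' where C': "C' > 0" and T: "\<And>h f. h \<in> {1..H} \<Longrightarrow> bcont_on S f \<Longrightarrow> bd C' h f" by blast
    show "\<forall>h\<in>{1..H}. rk h \<and> (\<exists>\<mu>. \<exists>C>0. rp h \<mu> C)"
    proof
      fix h assume h: "h \<in> {1..H}"
      have T_coeffs: "\<exists>b. summable (\<lambda>i. (b i)\<^sup>2) \<and> (\<forall>x\<in>S \<times> A. (\<lambda>i. b i * \<phi> i x) sums (R h x + E h f x)) \<and>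
          (\<Sum>i. (b i)\<^sup>2) \<le> (C' * (sup_norm_on S f + 1))\<^sup>2" if f: "bcont_on S f" for f
      proof -
        from T[OF h f] have T_in: "in_rkhs k (S \<times> A) (\<lambda>x. R h x + E h f x)"
          and n: "rkhs_norm k (S \<times> A) (\<lambda>x. R h x + E h f x) \<le> C' * (sup_norm_on S f + 1)"
          by (simp_all add: bd_def R_def E_def)
        obtain b where b: "summable (\<lambda>i. (b i)\<^sup>2)"
          "\<And>x. x \<in> S \<times> A \<Longrightarrow> (\<lambda>i. b i * \<phi> i x) sums (R h x + E h f x)"
          "rkhs_norm k (S \<times> A) (\<lambda>x. R h x + E h f x) = sqrt (\<Sum>i. (b i)\<^sup>2)"
          using in_rkhs_coeffs[OF T_in] by blast
        have "(\<Sum>i. (b i)\<^sup>2) \<le> (C' * (sup_norm_on S f + 1))\<^sup>2"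
          using n b(3) by (intro sqrt_le_D) simp
        then show ?thesis using b by blast
      qed
      \<comment> \<open>At \<open>f = 0\<close> the operator returns the reward, with norm at most
        \<open>C'\<close>.\<close>
      have zero: "bcont_on S (\<lambda>_. 0)" by (auto simp: bcont_on_def intro!: boundedI[of _ 0])
      have z0: "sup_norm_on S (\<lambda>_. 0) = 0" using ne by (simp add: sup_norm_on_def)
      have E0: "E h (\<lambda>_. 0) x = 0" for x by (simp add: E_def)
      obtain a where a: "summable (\<lambda>i. (a i)\<^sup>2)" "\<And>x. x \<in> S \<times> A \<Longrightarrow> (\<lambda>i. a i * \<phi> i x) sums R h x"
        "(\<Sum>i. (a i)\<^sup>2) \<le> C'\<^sup>2" using T_coeffs[OF zero] unfolding z0 E0 by auto
      have r_in: "rk h" using in_rkhs_of_coeffs[OF a(1,2)] by (simp add: rk_def R_def[abs_def])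
      \<comment> \<open>On the unit ball the operator has norm at most 2 C' and the reward at most
        \<open>C'\<close>; \<open>two_squares\<close> gives 2 * 4 + 2 * 1 = 10.\<close>
      have unit: "\<exists>d. summable (\<lambda>i. (d i)\<^sup>2) \<and> (\<forall>x\<in>S \<times> A. (\<lambda>i. d i * \<phi> i x) sums E h f x) \<and> (\<Sum>i. (d i)\<^sup>2) \<le> 10 * C'\<^sup>2"
        if f: "bcont_on S f" and f1: "sup_norm_on S f \<le> 1" for f
      proof -
        obtain b where b: "summable (\<lambda>i. (b i)\<^sup>2)" "\<And>x. x \<in> S \<times> A \<Longrightarrow> (\<lambda>i. b i * \<phi> i x) sums (R h x + E h f x)"
          "(\<Sum>i. (b i)\<^sup>2) \<le> (C' * (sup_norm_on S f + 1))\<^sup>2" using T_coeffs[OF f] by blast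
        have "(C' * (sup_norm_on S f + 1))\<^sup>2 \<le> (C' * 2)\<^sup>2"
          using f1 sup0[OF f] C' by (intro power_mono mult_left_mono) auto
        then have b4: "(\<Sum>i. (b i)\<^sup>2) \<le> 4 * C'\<^sup>2" using b(3) by (simp add: power_mult_distrib)
        define d where "d i = b i + (-1) * a i" for i
        have "summable (\<lambda>i. (d i)\<^sup>2)" using summable_square_lincomb(1)[OF b(1) a(1), of 1 "-1"] by (simp add: d_def)
        moreover have "(\<lambda>i. d i * \<phi> i x) sums E h f x" if "x \<in> S \<times> A" for x
          using sums_diff[OF b(2)[OF that] a(2)[OF that]] by (simp add: d_def left_diff_distrib)
        moreover have "(\<Sum>i. (d i)\<^sup>2) \<le> 10 * C'\<^sup>2"
          using two_squares[OF b(1) a(1), of "-1"] a(3) b4 unfolding d_def by simp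
        ultimately show ?thesis by blast
      qed
      \<comment> \<open>After the reward is subtracted the map is homogeneous in \<open>f\<close>,
        so the constant bound on the unit ball becomes one proportional to the squared sup
        norm.\<close>
      have E_coeffs: "\<exists>d. summable (\<lambda>i. (d i)\<^sup>2) \<and> (\<forall>x\<in>S \<times> A. (\<lambda>i. d i * \<phi> i x) sums E h f x) \<and>
          (\<Sum>i. (d i)\<^sup>2) \<le> 10 * C'\<^sup>2 * (sup_norm_on S f)\<^sup>2" if f: "bcont_on S f" for f
      proof -
        define F where "F = sup_norm_on S f"
        obtain d where d: "summable (\<lambda>i. (d i)\<^sup>2)" "(\<Sum>i. (d i)\<^sup>2) \<le> 10 * C'\<^sup>2"
          "\<And>x. x \<in> S \<times> A \<Longrightarrow> (\<lambda>i. d i * \<phi> i x) sums E h (\<lambda>s. f s / F) x"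
          using unit[OF sup_norm_on_scale(1,2)[OF f ne(1)]] unfolding F_def by blast
        have EF: "F * E h (\<lambda>s. f s / F) x = E h f x" if x: "x \<in> S \<times> A" for x
        \<comment> \<open>Here the rescaling cannot be undone, but \<open>f\<close> vanishes on
          \<open>S\<close>, which is the whole space of each transition measure, so both sides are
          0.\<close>
        proof (cases "F = 0")
          case True
          then have f0: "f s = 0" if "s \<in> S" for s using sup_norm_on_upper[OF f that] by (simp add: F_def)
          have "space (P h (fst x) (snd x)) = S"
            using P_prob h x sets_eq_imp_space_eq[of "P h (fst x) (snd x)" "restrict_space borel S"]
            by (auto simp: space_restrict_space)
          then have "E h f x = (\<integral>s'. 0 \<partial>(P h (fst x) (snd x)))"
            unfolding E_def using f0 by (intro Bochner_Integration.integral_cong) auto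
          then show ?thesis using True by simp
        qed (simp add: E_def)
        have "summable (\<lambda>i. (F * d i)\<^sup>2)" "(\<Sum>i. (F * d i)\<^sup>2) = F\<^sup>2 * (\<Sum>i. (d i)\<^sup>2)"
          using d(1) by (simp_all add: power_mult_distrib summable_mult suminf_mult)
        moreover have "F\<^sup>2 * (\<Sum>i. (d i)\<^sup>2) \<le> 10 * C'\<^sup>2 * F\<^sup>2"
          using mult_left_mono[OF d(2), of "F\<^sup>2"] by (simp add: mult.commute)
        moreover have "(\<lambda>i. F * d i * \<phi> i x) sums E h f x" if "x \<in> S \<times> A" for x
          using sums_mult[OF d(3)[OF that], of F] EF[OF that] by (simp add: mult.assoc)
        ultimately show ?thesis unfolding F_def[symmetric] by (intro exI[of _ "\<lambda>i. F * d i"]) auto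
      qed
      \<comment> \<open>Mixing the transitions with weight \<open>\<psi> i\<close> gives, for all
        \<open>f\<close> at once, the i-th Fourier coefficient of the expectation as an integral of
        \<open>f\<close>.\<close>
      have "\<exists>\<mu>. fin_signed_measure_on S \<mu> \<and> (\<forall>f. bcont_on S f \<longrightarrow> signed_integral \<mu> f = (\<integral>x. E h f x * \<psi> i x \<partial>\<rho>))" for i
      proof -
        obtain \<mu> where "fin_signed_measure_on S \<mu>"
          "\<And>f. bcont_on S f \<Longrightarrow> signed_integral \<mu> f = (\<integral>x. (\<integral>s. f s \<partial>(P h (fst x) (snd x))) * \<psi> i x \<partial>\<rho>)"
        proof (rule signed_mixture[OF \<rho>_prob S_closed, of "\<lambda>x. P h (fst x) (snd x)" "\<psi> i"])
          show "(\<lambda>x. \<integral>s. f s \<partial>P h (fst x) (snd x)) \<in> borel_measurable \<rho>" if "bcont_on S f" for f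
            using ck.cont_measurable[OF E_cont[OF h that]] by (simp add: E_def[abs_def])
        qed (use P_prob h \<psi>_int in auto)
        then show ?thesis by (intro exI[of _ \<mu>]) (simp add: E_def)
      qed
      then obtain \<mu> where \<mu>: "\<And>i. fin_signed_measure_on S (\<mu> i)"
        "\<And>i f. bcont_on S f \<Longrightarrow> signed_integral (\<mu> i) f = (\<integral>x. E h f x * \<psi> i x \<partial>\<rho>)" by metis
      have "((\<lambda>n. \<integral>x. (E h f x - (\<Sum>i<n. signed_integral (\<mu> i) f * \<psi> i x))\<^sup>2 \<partial>\<rho>) \<longlonglongrightarrow> 0) \<and>
          summable (\<lambda>i. (signed_integral (\<mu> i) f)\<^sup>2 / lam i) \<and>
          (\<Sum>i. (signed_integral (\<mu> i) f)\<^sup>2 / lam i) \<le> 10 * C'\<^sup>2 * (sup_norm_on S f)\<^sup>2" if f: "bcont_on S f" for f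
      proof -
        obtain d where d: "summable (\<lambda>i. (d i)\<^sup>2)" "\<And>x. x \<in> S \<times> A \<Longrightarrow> (\<lambda>i. d i * \<phi> i x) sums E h f x"
          "(\<Sum>i. (d i)\<^sup>2) \<le> 10 * C'\<^sup>2 * (sup_norm_on S f)\<^sup>2" using E_coeffs[OF f] by blast
        have Ec: "continuous_on (S \<times> A) (E h f)" by (rule E_cont[OF h f])
        \<comment> \<open>The expansion of the expectation in the features has the Fourier
          coefficients \<open>d i * sqrt (lam i)\<close>, so dividing their squares by
          \<open>lam i\<close> recovers the squared RKHS coefficients.\<close>
        have si: "signed_integral (\<mu> i) f = d i * sqrt (lam i)" for i
          using \<mu>(2)[OF f] int_e[OF ck.cont_measurable[OF Ec]] expansion_L2(1)[OF d(1,2)] by simp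
        have "(signed_integral (\<mu> i) f)\<^sup>2 / lam i = (d i)\<^sup>2" for i
          using lam_pos[rule_format, of i] by (simp add: si power_mult_distrib)
        then show ?thesis using d expansion_L2(2)[OF d(1,2)] by (simp add: L2_e[OF Ec] si)
      qed
      then have "rp h \<mu> (10 * C'\<^sup>2)" using \<mu>(1) by (simp add: rp_def E_def)
      moreover have "10 * C'\<^sup>2 > 0" using C' by simp
      ultimately show "rk h \<and> (\<exists>\<mu>. \<exists>C>0. rp h \<mu> C)" using r_in by blast
    qed
  qed
  then show ?thesis unfolding rk_def rp_def bd_def .
qed

end
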